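(* For every fixed positive integer $M$, the nearest neighbour compliance problem (NNCP), restricted to instances whose coupling graph is a complete bipartite graph $K_{M,N}$ (with $N$ arbitrary), is solvable in polynomial time. In particular, the NNCP on the star graphs $K_{1,N}$ is polynomial time solvable.
   Context: Notation: $[n]=\{1,\dots,n\}$; $\mathbb{S}_n$ is the symmetric group on $[n]$; products of permutations are compositions $\tau\sigma=\tau\circ\sigma$; for a set $S$, $\tau^{-1}(S)=\{\tau^{-1}(s): s\in S\}$. A coupling graph is a simple undirected connected graph $\mathrm{Coup}(E)=(L,E)$ with vertex set $L=[n]$ (locations) and $E$ a set of two-element subsets of $L$. Let $Q=\{q_1,\dots,q_n\}$ be a set of $n$ qubits, identified with $[n]$. A qubit order is a bijection $\tau:L\to Q$, i.e. an element of $\mathbb{S}_n$. A gate is a two-element subset of $Q$; a quantum circuit is $\Gamma=(Q,C)$ with $C=(g^1,\dots,g^m)$ a finite sequence of gates. A qubit order $\tau$ complies with a gate $g$ if $\tau^{-1}(g)\in E$. Let $T=\{(i~j)\in\mathbb{S}_n : \{i,j\}\in E\}$ and $J_T(\tau_1,\tau_2)=\min\{k : \tau_2=\tau_1\sigma_1\cdots\sigma_k,\ \sigma_1,\dots,\sigma_k\in T\}$. NNCP: given a quantum circuit $\Gamma=(Q,C)$ with $n$ qubits and $m$ gates and a coupling graph $\mathrm{Coup}(E)$ on $[n]$, find qubit orders $\tau^1,\dots,\tau^m$ such that $\tau^k$ complies with $g^k$ for all $k\in[m]$ and $\sum_{k=1}^{m-1}J_T(\tau^k,\tau^{k+1})$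 is minimum. For the coupling graph $K_{M,N}$ one has $n=M+N$. Polynomial time means polynomial in $n$ and $m$. *)

theory Defs
  imports "HOL-Combinatorics.Permutations"
begin

section \<open>The nearest neighbour compliance problem\<close>

text \<open>
  Locations and qubits are both identified with \<open>{1..n}\<close>.  Qubit orders and their compositions
  are functions on \<^typ>\<open>nat\<close> that are the identity outside \<open>{1..n}\<close>
  (\<^term>\<open>\<tau> permutes {1..n}\<close>).
\<close>

definition coupling_graph :: "nat \<Rightarrow> nat set set \<Rightarrow> bool" where
  "coupling_graph n E \<longleftrightarrow>
     (\<forall>e\<in>E. e \<subseteq> {1..n} \<and> card e = 2) \<and>
     (\<forall>i\<in>{1..n}. \<forall>j\<in>{1..n}. (i, j) \<in> {(a, b). {a, b} \<in> E}\<^sup>*)"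

definition circuit :: "nat \<Rightarrow> nat set list \<Rightarrow> bool" where
  "circuit n C \<longleftrightarrow> (\<forall>g\<in>set C. g \<subseteq> {1..n} \<and> card g = 2)"

definition complies :: "nat set set \<Rightarrow> (nat \<Rightarrow> nat) \<Rightarrow> nat set \<Rightarrow> bool" where
  "complies E \<tau> g \<longleftrightarrow> inv \<tau> ` g \<in> E"

definition edge_transpositions :: "nat set set \<Rightarrow> (nat \<Rightarrow> nat) set" where
  "edge_transpositions E = {transpose i j | i j. {i, j} \<in> E}"

text \<open>
  Here \<open>foldl (\<circ>) \<tau>\<^sub>1 [\<sigma>\<^sub>1, \<dots>, \<sigma>\<^sub>k]\<close> is \<open>\<tau>\<^sub>1 \<circ> \<sigma>\<^sub>1 \<circ> \<dots> \<circ> \<sigma>\<^sub>k\<close>.  For a connected graph and qubit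
  orders \<open>\<tau>\<^sub>1\<close>, \<open>\<tau>\<^sub>2\<close> such a \<open>k\<close> exists, so that the minimum is meaningful.
\<close>

definition J :: "(nat \<Rightarrow> nat) set \<Rightarrow> (nat \<Rightarrow> nat) \<Rightarrow> (nat \<Rightarrow> nat) \<Rightarrow> nat" where
  "J T \<tau>\<^sub>1 \<tau>\<^sub>2 = (LEAST k. \<exists>\<sigma>s. length \<sigma>s = k \<and> set \<sigma>s \<subseteq> T \<and> \<tau>\<^sub>2 = foldl (\<circ>) \<tau>\<^sub>1 \<sigma>s)"

definition nncp_feasible :: "nat \<Rightarrow> nat set set \<Rightarrow> nat set list \<Rightarrow> (nat \<Rightarrow> nat) list \<Rightarrow> bool" where
  "nncp_feasible n E C \<tau>s \<longleftrightarrow>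
     length \<tau>s = length C \<and>
     (\<forall>k<length C. \<tau>s ! k permutes {1..n} \<and> complies E (\<tau>s ! k) (C ! k))"

definition nncp_cost :: "nat set set \<Rightarrow> (nat \<Rightarrow> nat) list \<Rightarrow> nat" where
  "nncp_cost E \<tau>s =
     (\<Sum>k<length \<tau>s - 1. J (edge_transpositions E) (\<tau>s ! k) (\<tau>s ! Suc k))"

definition nncp_solution :: "nat \<Rightarrow> nat set set \<Rightarrow> nat set list \<Rightarrow> (nat \<Rightarrow> nat) list \<Rightarrow> bool" where
  "nncp_solution n E C \<tau>s \<longleftrightarrow>
     nncp_feasible n E C \<tau>s \<and>
     (\<forall>\<tau>s'. nncp_feasible n E C \<tau>s' \<longrightarrow> nncp_cost E \<tau>s \<le> nncp_cost E \<tau>s')"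

text \<open>
  A graph on \<open>{1..n}\<close> is given by the pair \<open>(n, E)\<close>.  All labellings are admitted: the two sides
  may be any partition of \<open>{1..M + N}\<close> into sets of sizes \<open>M\<close> and \<open>N\<close>.
\<close>

definition complete_bipartite :: "nat \<Rightarrow> nat \<Rightarrow> (nat \<times> nat set set) set" where
  "complete_bipartite M N =
     {(M + N, {{a, b} | a b. a \<in> A \<and> b \<in> B}) | A B.
        A \<union> B = {1..M + N} \<and> A \<inter> B = {} \<and> card A = M \<and> card B = N}"


section \<open>Model of computation\<close>

text \<open>
  First-order call-by-value recursive programs on binary trees (pure LISP without atoms other
  than nil), in the style of Neil Jones, \<^emph>\<open>Computability and Complexity from a Programming
  Perspective\<close>.  Every evaluation step has unit cost.  The only test is whether a value is nil,
  so on shared (pointer) representations of trees each step is a constant number of pointer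
  operations, for a fixed program; hence polynomial time here agrees with polynomial time on
  Turing machines (for outputs of polynomial size, as is the case below).
\<close>

datatype tree = Leaf | Node tree tree

fun left :: "tree \<Rightarrow> tree" where
  "left Leaf = Leaf"
| "left (Node l r) = l"

fun right :: "tree \<Rightarrow> tree" where
  "right Leaf = Leaf"
| "right (Node l r) = r"

datatype exp =
    Var nat
  | LeafE
  | NodeE exp exp
  | LeftE exp
  | RightE exp
  | IfE exp exp exp
  | Call nat "exp list"

text \<open>
  A program is the list of the bodies of its functions; \<open>Var i\<close> denotes the \<open>i\<close>-th argument of the
  function whose body is evaluated.
\<close>

type_synonym prog = "exp list"

inductive eval :: "prog \<Rightarrow> tree list \<Rightarrow> exp \<Rightarrow> tree \<Rightarrow> nat \<Rightarrow> bool"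
  and evals :: "prog \<Rightarrow> tree list \<Rightarrow> exp list \<Rightarrow> tree list \<Rightarrow> nat \<Rightarrow> bool"
  for P :: prog where
  Var: "i < length vs \<Longrightarrow> eval P vs (Var i) (vs ! i) 1"
| Leaf: "eval P vs LeafE Leaf 1"
| Node: "eval P vs e\<^sub>1 v\<^sub>1 t\<^sub>1 \<Longrightarrow> eval P vs e\<^sub>2 v\<^sub>2 t\<^sub>2 \<Longrightarrow>
    eval P vs (NodeE e\<^sub>1 e\<^sub>2) (Node v\<^sub>1 v\<^sub>2) (1 + t\<^sub>1 + t\<^sub>2)"
| Left: "eval P vs e v t \<Longrightarrow> eval P vs (LeftE e) (left v) (1 + t)"
| Right: "eval P vs e v t \<Longrightarrow> eval P vs (RightE e) (right v) (1 + t)"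
| IfNode: "eval P vs e v t \<Longrightarrow> v \<noteq> Leaf \<Longrightarrow> eval P vs e\<^sub>1 v\<^sub>1 t\<^sub>1 \<Longrightarrow>
    eval P vs (IfE e e\<^sub>1 e\<^sub>2) v\<^sub>1 (1 + t + t\<^sub>1)"
| IfLeaf: "eval P vs e Leaf t \<Longrightarrow> eval P vs e\<^sub>2 v\<^sub>2 t\<^sub>2 \<Longrightarrow>
    eval P vs (IfE e e\<^sub>1 e\<^sub>2) v\<^sub>2 (1 + t + t\<^sub>2)"
| Call: "evals P vs es ws t \<Longrightarrow> f < length P \<Longrightarrow> eval P ws (P ! f) v t' \<Longrightarrow>
    eval P vs (Call f es) v (1 + t + t')"
| NoArgs: "evals P vs [] [] 0"
| MoreArgs: "eval P vs e w t \<Longrightarrow> evals P vs es ws t' \<Longrightarrow>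
    evals P vs (e # es) (w # ws) (t + t')"

lemma eval_deterministic:
  "eval P vs e v t \<Longrightarrow> eval P vs e v' t' \<Longrightarrow> v' = v \<and> t' = t"
  "evals P vs es ws s \<Longrightarrow> evals P vs es ws' s' \<Longrightarrow> ws' = ws \<and> s' = s"
proof (induction arbitrary: v' t' and ws' s' rule: eval_evals.inducts)
  case Var
  from Var.prems show ?case by cases auto
next
  case Leaf
  from Leaf.prems show ?case by cases auto
next
  case Node
  from Node.prems show ?case by cases (metis Node.IH)+
next
  case Left
  from Left.prems show ?case by cases (metis Left.IH)+
next
  case Right
  from Right.prems show ?case by cases (metis Right.IH)+
next
  case IfNode
  from IfNode.prems show ?case by cases (metis IfNode.IH IfNode.hyps)+
next
  case IfLeaf
  from IfLeaf.prems show ?case by cases (metis IfLeaf.IH)+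
next
  case Call
  from Call.prems show ?case by cases (metis Call.IH)+
next
  case NoArgs
  from NoArgs.prems show ?case by cases auto
next
  case MoreArgs
  from MoreArgs.prems show ?case by cases (metis MoreArgs.IH)+
qed

text \<open>Execution starts by calling function number 0 with the input as its only argument.\<close>

definition computes :: "prog \<Rightarrow> tree \<Rightarrow> tree \<Rightarrow> nat \<Rightarrow> bool" where
  "computes P x y t \<longleftrightarrow> P \<noteq> [] \<and> eval P [x] (P ! 0) y t"


section \<open>Encodings and polynomial-time solvability\<close>

fun enc_list :: "('a \<Rightarrow> tree) \<Rightarrow> 'a list \<Rightarrow> tree" where
  "enc_list f [] = Leaf"
| "enc_list f (x # xs) = Node (f x) (enc_list f xs)"

text \<open>
  Numbers are in unary.  This is harmless because running time is measured in the number of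
  qubits and of gates, and every number that occurs is at most \<open>n\<close>.
\<close>

definition enc_nat :: "nat \<Rightarrow> tree" where
  "enc_nat k = enc_list (\<lambda>_. Leaf) [0..<k]"

definition enc_bool :: "bool \<Rightarrow> tree" where
  "enc_bool b = (if b then Node Leaf Leaf else Leaf)"

definition enc_graph :: "nat \<Rightarrow> nat set set \<Rightarrow> tree" where
  "enc_graph n E = enc_list (\<lambda>i. enc_list (\<lambda>j. enc_bool ({i, j} \<in> E)) [1..<Suc n]) [1..<Suc n]"

definition enc_gate :: "nat set \<Rightarrow> tree" where
  "enc_gate g = Node (enc_nat (Min g)) (enc_nat (Max g))"

definition enc_instance :: "nat \<Rightarrow> nat set set \<Rightarrow> nat set list \<Rightarrow> tree" where
  "enc_instance n E C = Node (enc_nat n) (Node (enc_graph n E) (enc_list enc_gate C))"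

definition enc_orders :: "nat \<Rightarrow> (nat \<Rightarrow> nat) list \<Rightarrow> tree" where
  "enc_orders n \<tau>s = enc_list (\<lambda>\<tau>. enc_list (\<lambda>i. enc_nat (\<tau> i)) [1..<Suc n]) \<tau>s"

text \<open>
  The problem restricted to the coupling graphs in the class \<open>\<G>\<close>: a single program solves all
  instances, in time polynomial in \<open>n\<close> and \<open>m = length C\<close>.  Any polynomial in \<open>n\<close> and \<open>m\<close> is
  bounded by one of the form \<open>c * (n + m) ^ d + c\<close>.
\<close>

definition nncp_polynomial_time_on :: "(nat \<times> nat set set) set \<Rightarrow> bool" where
  "nncp_polynomial_time_on \<G> \<longleftrightarrow>
     (\<exists>P c d. \<forall>n E C. (n, E) \<in> \<G> \<longrightarrow> coupling_graph n E \<longrightarrow> circuit n C \<longrightarrow>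
        (\<exists>\<tau>s t. computes P (enc_instance n E C) (enc_orders n \<tau>s) t \<and>
           nncp_solution n E C \<tau>s \<and>
           t \<le> c * (n + length C) ^ d + c))"

end

theory Submission
  imports Defs
begin

text \<open>
  Whether a qubit order complies with a gate depends only on the set of qubits placed on one side of
  the bipartite graph.  The whole problem can be reduced to these sets.  An edge transposition moves
  one qubit into the set and one out of it, so at least \<open>|S - S'|\<close> transpositions are needed between
  orders with sets \<open>S\<close> and \<open>S'\<close>.  Conversely, any two qubits on different sides can be exchanged by a
  single edge transposition.  As one side has \<open>M\<close> elements, there are at most \<open>n ^ M\<close> such sets, which
  is polynomial for fixed \<open>M\<close>.

  The algorithm is a dynamic program over these sets, from the last gate to the first.  Its table has
  one entry for each set reached, with the cheapest sequence of orders found.  Not all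
  transitions between sets have to be tried, as one exchange per gate is enough: exchanges that the
  current gate does not require can be postponed, and a gate that is violated is always repaired by
  one exchange towards the set that a given optimal solution has at that gate (\<open>lazy_move\<close>).  The
  invariant \<open>complete\<close> therefore compares an entry of the table with an arbitrary solution by the cost
  of the entry plus its distance to the current set of the solution.  Before the first gate is
  processed, \<open>n\<close> rounds of exchanges free of charge produce all sets of the right size, since the
  search may start from any order at no cost.  The outcome is \<open>search_correct\<close>.

  The program that carries this out is a collection of folds over lists.  Its evaluation is described
  by rules that determine the value and an upper bound for the time of an expression together, so
  that each function is verified by symbolic execution (\<open>runs_fold\<close> treats the recursion).  The bounds
  are polynomials in the number of qubits, the number of gates and the size of the table.
\<close>

section \<open>Exchanges and the cost of a qubit order sequence\<close>

text \<open>
  The relaxation behind the lower bound: of a qubit order only the set of qubits on one fixed side of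
  the graph is kept.  A gate is complied with iff that set contains exactly one of its two qubits, and
  passing from one set to the next is charged the number of qubits that have to change sides.
\<close>

fun gates_split :: "nat set list \<Rightarrow> nat set list \<Rightarrow> bool" where
  "gates_split [] [] \<longleftrightarrow> True"
| "gates_split (g # gs) (S # Ss) \<longleftrightarrow> card (g \<inter> S) = 1 \<and> gates_split gs Ss"
| "gates_split _ _ \<longleftrightarrow> False"

fun exchange_cost :: "nat set list \<Rightarrow> nat" where
  "exchange_cost (S # S' # Ss) = card (S - S') + exchange_cost (S' # Ss)"
| "exchange_cost _ = 0"

lemma card_diff_triangle:
  assumes "finite A" "finite B"
  shows "card (A - C) \<le> card (A - B) + card (B - C)"
proof -
  have "card (A - C) \<le> card ((A - B) \<union> (B - C))"
    using assms by (intro card_mono) auto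
  also have "\<dots> \<le> card (A - B) + card (B - C)" by (rule card_Un_le)
  finally show ?thesis .
qed

lemma card_diff_commute:
  assumes "finite A" "finite B" "card A = card B"
  shows "card (A - B) = card (B - A)"
  using assms by (simp add: card_Diff_subset_Int Int_commute)

lemma nncp_cost_Nil: "nncp_cost E [] = 0"
  by (simp add: nncp_cost_def)

lemma nncp_cost_single: "nncp_cost E [\<tau>] = 0"
  by (simp add: nncp_cost_def)

lemma nncp_cost_Cons:
  "nncp_cost E (\<tau> # \<tau>' # \<tau>s) = J (edge_transpositions E) \<tau> \<tau>' + nncp_cost E (\<tau>' # \<tau>s)"
  unfolding nncp_cost_def by (simp add: sum.lessThan_Suc_shift del: sum.lessThan_Suc)

lemma nncp_feasible_Nil: "nncp_feasible n E [] \<tau>s \<longleftrightarrow> \<tau>s = []"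
  by (simp add: nncp_feasible_def)

lemma nncp_feasible_Cons:
  "nncp_feasible n E (g # C) (\<tau> # \<tau>s) \<longleftrightarrow>
     \<tau> permutes {1..n} \<and> complies E \<tau> g \<and> nncp_feasible n E C \<tau>s"
  unfolding nncp_feasible_def by (auto simp: less_Suc_eq_0_disj)

lemma foldl_comp: fixes f :: "'a \<Rightarrow> 'a" shows "foldl (\<circ>) f \<sigma>s = f \<circ> foldl (\<circ>) id \<sigma>s"
proof (induction \<sigma>s arbitrary: f)
  case (Cons \<sigma> \<sigma>s)
  from Cons.IH[of "f \<circ> \<sigma>"] Cons.IH[of \<sigma>] show ?case by (simp add: comp_assoc)
qed simp

text \<open>
  A coupling graph in which two locations are adjacent iff they lie on different sides.  The sides are
  given by a Boolean labelling because this is what a row of the adjacency matrix provides.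
\<close>

locale bipartite =
  fixes n :: nat and E :: "nat set set" and side :: "nat \<Rightarrow> bool"
  assumes edge_iff: "{i, j} \<in> E \<longleftrightarrow> i \<in> {1..n} \<and> j \<in> {1..n} \<and> side i \<noteq> side j"
    and inhabited: "\<exists>i\<in>{1..n}. side i = b"
begin

definition occupied :: "(nat \<Rightarrow> nat) \<Rightarrow> nat set" where
  "occupied \<tau> = {q \<in> {1..n}. side (inv \<tau> q)}"

definition capacity :: nat where
  "capacity = card {i \<in> {1..n}. side i}"

lemma occupied_subset: "occupied \<tau> \<subseteq> {1..n}"
  by (auto simp: occupied_def)

lemma finite_occupied: "finite (occupied \<tau>)"
  using occupied_subset finite_subset by blast

lemma occupied_image:
  assumes "\<tau> permutes {1..n}"
  shows "occupied \<tau> = \<tau> ` {i \<in> {1..n}. side i}"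
proof -
  have "q \<in> \<tau> ` {i \<in> {1..n}. side i}" if "q \<in> {1..n}" "side (inv \<tau> q)" for q
    using that permutes_in_image[OF permutes_inv[OF assms], of q] permutes_inverses(1)[OF assms, of q]
    by (metis (mono_tags, lifting) image_eqI mem_Collect_eq)
  moreover have "\<tau> i \<in> {1..n}" if "i \<in> {1..n}" for i
    using that permutes_in_image[OF assms] by blast
  ultimately show ?thesis
    unfolding occupied_def using permutes_inverses(2)[OF assms] by auto
qed

lemma card_occupied: "\<tau> permutes {1..n} \<Longrightarrow> card (occupied \<tau>) = capacity"
  unfolding occupied_image capacity_def
  by (intro card_image inj_on_subset[OF permutes_inj]) auto

lemma complies_iff:
  assumes "\<tau> permutes {1..n}" "a \<in> {1..n}" "b \<in> {1..n}"
  shows "complies E \<tau> {a, b} \<longleftrightarrow> (a \<in> occupied \<tau>) \<noteq> (b \<in> occupied \<tau>)"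
  using assms permutes_in_image[OF permutes_inv[OF assms(1)]]
  by (simp add: complies_def edge_iff occupied_def)

lemma complies_iff_card:
  assumes "\<tau> permutes {1..n}" "g \<subseteq> {1..n}" "card g = 2"
  shows "complies E \<tau> g \<longleftrightarrow> card (g \<inter> occupied \<tau>) = 1"
proof -
  from assms(3) obtain a b where g: "g = {a, b}" "a \<noteq> b" by (meson card_2_iff)
  have "card ({a, b} \<inter> S) = 1 \<longleftrightarrow> (a \<in> S) \<noteq> (b \<in> S)" for S
    using g(2) by (auto simp: Int_insert_left)
  then show ?thesis using assms g by (simp add: complies_iff)
qed

text \<open>
  Two locations on the same side are exchanged by conjugating with a location \<open>k\<close> on the other side:
  \<open>(i j) = (i k)(j k)(i k)\<close>.
\<close>

lemma transposition_generated:
  assumes "i \<in> {1..n}" "j \<in> {1..n}" "i \<noteq> j"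
  shows "\<exists>\<sigma>s. set \<sigma>s \<subseteq> edge_transpositions E \<and> foldl (\<circ>) id \<sigma>s = transpose i j"
proof (cases "side i = side j")
  case False
  then have "transpose i j \<in> edge_transpositions E"
    using assms edge_iff by (auto simp: edge_transpositions_def)
  then show ?thesis by (intro exI[of _ "[transpose i j]"]) auto
next
  case True
  obtain k where k: "k \<in> {1..n}" "side k \<noteq> side i" using inhabited[of "\<not> side i"] by blast
  then have "{transpose i k, transpose j k} \<subseteq> edge_transpositions E"
    using assms edge_iff True by (auto simp: edge_transpositions_def)
  moreover have "i \<noteq> k" "j \<noteq> k" using k True by auto
  then have "transpose i k \<circ> transpose j k \<circ> transpose i k = transpose i j"
    using assms(3) by (auto simp: fun_eq_iff transpose_def)
  ultimately show ?thesis
    by (intro exI[of _ "[transpose i k, transpose j k, transpose i k]"]) auto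
qed

text \<open>
  \<^const>\<open>J\<close> is a least element, about which nothing is known unless some product of edge
  transpositions has the required value; this lemma supplies one.
\<close>

lemma permutation_generated:
  assumes "\<pi> permutes {1..n}"
  shows "\<exists>\<sigma>s. set \<sigma>s \<subseteq> edge_transpositions E \<and> foldl (\<circ>) id \<sigma>s = \<pi>"
  using finite_atLeastAtMost assms
proof (induction rule: permutes_rev_induct)
  case id
  show ?case by (intro exI[of _ "[]"]) auto
next
  case (swap a b p)
  from swap.IH swap.hyps transposition_generated[of a b] obtain \<sigma>s \<sigma>s'
    where "set \<sigma>s \<subseteq> edge_transpositions E" "foldl (\<circ>) id \<sigma>s = p"
      "set \<sigma>s' \<subseteq> edge_transpositions E" "foldl (\<circ>) id \<sigma>s' = transpose a b"
    by blast
  then show ?case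
    by (intro exI[of _ "\<sigma>s @ \<sigma>s'"]) (metis foldl_append foldl_comp set_append Un_least)
qed

lemma occupied_edge_transposition:
  assumes "\<tau> permutes {1..n}" "\<sigma> \<in> edge_transpositions E"
  shows "\<tau> \<circ> \<sigma> permutes {1..n}" "card (occupied \<tau> - occupied (\<tau> \<circ> \<sigma>)) \<le> 1"
proof -
  from assms(2) obtain i j where \<sigma>: "\<sigma> = transpose i j" "{i, j} \<in> E"
    by (auto simp: edge_transpositions_def)
  then have ij: "i \<in> {1..n}" "j \<in> {1..n}" "side i \<noteq> side j" by (auto simp: edge_iff)
  then show perm: "\<tau> \<circ> \<sigma> permutes {1..n}"
    using \<sigma> assms(1) by (simp add: permutes_compose permutes_swap_id)
  \<comment> \<open>the only qubit that leaves is the one at the end of the edge with label \<^const>\<open>True\<close>\<close>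
  have "occupied \<tau> - occupied (\<tau> \<circ> \<sigma>) \<subseteq> {\<tau> (if side i then i else j)}"
  proof
    fix q assume q: "q \<in> occupied \<tau> - occupied (\<tau> \<circ> \<sigma>)"
    then obtain k where k: "k \<in> {1..n}" "side k" "q = \<tau> k"
      unfolding occupied_image[OF assms(1)] by blast
    have "k = i \<or> k = j"
    proof (rule ccontr)
      assume "\<not> (k = i \<or> k = j)"
      then have "q = (\<tau> \<circ> \<sigma>) k" by (simp add: \<sigma> k transpose_def)
      with k q show False unfolding occupied_image[OF perm] by blast
    qed
    with k ij show "q \<in> {\<tau> (if side i then i else j)}" by auto
  qed
  then show "card (occupied \<tau> - occupied (\<tau> \<circ> \<sigma>)) \<le> 1"
    using card_mono[of "{\<tau> (if side i then i else j)}"] by simp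
qed

lemma occupied_diff_le_length:
  assumes "\<tau> permutes {1..n}" "set \<sigma>s \<subseteq> edge_transpositions E"
  shows "card (occupied \<tau> - occupied (foldl (\<circ>) \<tau> \<sigma>s)) \<le> length \<sigma>s"
  using assms
proof (induction \<sigma>s arbitrary: \<tau>)
  case (Cons \<sigma> \<sigma>s)
  then have \<sigma>: "\<sigma> \<in> edge_transpositions E" by simp
  note step = occupied_edge_transposition[OF Cons.prems(1) \<sigma>]
  have "card (occupied (\<tau> \<circ> \<sigma>) - occupied (foldl (\<circ>) (\<tau> \<circ> \<sigma>) \<sigma>s)) \<le> length \<sigma>s"
    by (rule Cons.IH[OF step(1)]) (use Cons.prems(2) in auto)
  with step(2) card_diff_triangle[OF finite_occupied finite_occupied,
      of \<tau> "occupied (foldl (\<circ>) (\<tau> \<circ> \<sigma>) \<sigma>s)" "\<tau> \<circ> \<sigma>"]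
  have "card (occupied \<tau> - occupied (foldl (\<circ>) (\<tau> \<circ> \<sigma>) \<sigma>s)) \<le> Suc (length \<sigma>s)"
    by simp
  then show ?case unfolding foldl_Cons length_Cons .
qed simp

lemma occupied_diff_le_J:
  assumes "\<tau> permutes {1..n}" "\<tau>' permutes {1..n}"
  shows "card (occupied \<tau> - occupied \<tau>') \<le> J (edge_transpositions E) \<tau> \<tau>'"
proof -
  let ?P = "\<lambda>k. \<exists>\<sigma>s. length \<sigma>s = k \<and> set \<sigma>s \<subseteq> edge_transpositions E \<and> \<tau>' = foldl (\<circ>) \<tau> \<sigma>s"
  obtain \<sigma>s where "set \<sigma>s \<subseteq> edge_transpositions E" "foldl (\<circ>) id \<sigma>s = inv \<tau> \<circ> \<tau>'"
    using permutation_generated[OF permutes_compose[OF assms(2) permutes_inv[OF assms(1)]]] by blast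
  moreover have "\<tau> \<circ> (inv \<tau> \<circ> \<tau>') = \<tau>'"
    using permutes_inverses(1)[OF assms(1)] by (auto simp: fun_eq_iff)
  ultimately have "?P (length \<sigma>s)" using foldl_comp[of \<tau> \<sigma>s] by auto
  then have "?P (J (edge_transpositions E) \<tau> \<tau>')"
    unfolding J_def by (rule LeastI)
  then show ?thesis using occupied_diff_le_length[OF assms(1)] by metis
qed

lemma J_refl: "J T \<tau> \<tau> = 0"
  unfolding J_def by (rule Least_eq_0) auto

text \<open>
  Exchanging the qubits \<open>p\<close> and \<open>q\<close> is multiplication from the left by \<open>(p q)\<close>, hence from the right
  by the transposition of their locations, which is an edge.  The direction of the cost, from the
  changed order to \<open>\<tau>\<close>, is the one that occurs when a solution is built from its end.
\<close>

lemma J_exchange_le: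
  assumes "\<tau> permutes {1..n}" "p \<in> {1..n}" "q \<in> {1..n}" "side (inv \<tau> p) \<noteq> side (inv \<tau> q)"
  shows "J (edge_transpositions E) (transpose p q \<circ> \<tau>) \<tau> \<le> 1"
proof -
  let ?\<sigma> = "transpose (inv \<tau> p) (inv \<tau> q)"
  have "?\<sigma> \<in> edge_transpositions E"
    using assms permutes_in_image[OF permutes_inv[OF assms(1)]]
    by (auto simp: edge_transpositions_def edge_iff)
  moreover have "\<tau> = transpose p q \<circ> \<tau> \<circ> ?\<sigma>"
    using permutes_inverses[OF assms(1)] by (auto simp: fun_eq_iff transpose_def)
  ultimately show ?thesis
    unfolding J_def by (intro Least_le exI[of _ "[?\<sigma>]"]) auto
qed

lemma exchange_cost_le_nncp_cost:
  assumes "nncp_feasible n E C \<tau>s" "circuit n C"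
  shows "gates_split C (map occupied \<tau>s) \<and> exchange_cost (map occupied \<tau>s) \<le> nncp_cost E \<tau>s"
  using assms
proof (induction \<tau>s arbitrary: C)
  case Nil
  then show ?case by (simp add: nncp_feasible_def)
next
  case (Cons \<tau> \<tau>s)
  then obtain g C' where C: "C = g # C'" by (cases C) (auto simp: nncp_feasible_Nil)
  with Cons.prems have \<tau>: "\<tau> permutes {1..n}" "complies E \<tau> g" and rest: "nncp_feasible n E C' \<tau>s"
    and g: "g \<subseteq> {1..n}" "card g = 2" and C': "circuit n C'"
    by (auto simp: nncp_feasible_Cons circuit_def)
  have "exchange_cost (map occupied (\<tau> # \<tau>s)) \<le> nncp_cost E (\<tau> # \<tau>s)"
  proof (cases \<tau>s)
    case Nil
    then show ?thesis by simp
  next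
    case (Cons \<tau>' \<tau>s')
    with rest have "\<tau>' permutes {1..n}" by (cases C') (auto simp: nncp_feasible_Cons
      nncp_feasible_Nil)
    then show ?thesis
      using occupied_diff_le_J[OF \<tau>(1)] Cons.IH[OF rest C'] Cons by (simp add: nncp_cost_Cons add_mono)
  qed
  then show ?case using Cons.IH[OF rest C'] \<tau> g C complies_iff_card[OF \<tau>(1) g] by simp
qed

end

section \<open>The search\<close>

text \<open>
  A state lists, for the locations \<open>1, \<dots>, n\<close>, the qubit placed there and the side of the location;
  so the graph itself is no longer needed once the first state has been built.  An entry of the table
  consists of a cost, the current state, and the orders already chosen.  Gates are processed from
  the last to the first, so that this list of orders grows at its front and ends up in the right
  order.

  Functions on lists are folds from the right, in the form in which the program carries them out.
\<close>

type_synonym state = "(nat \<times> bool) list"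
type_synonym entry = "nat \<times> state \<times> nat list list"

abbreviation cost :: "entry \<Rightarrow> nat" where "cost e \<equiv> fst e"
abbreviation state :: "entry \<Rightarrow> state" where "state e \<equiv> fst (snd e)"
abbreviation path :: "entry \<Rightarrow> nat list list" where "path e \<equiv> snd (snd e)"

definition side_at :: "state \<Rightarrow> nat \<Rightarrow> bool" where
  "side_at s x = foldr (\<lambda>e acc. if fst e = x then snd e else acc) s False"

definition same_sides :: "state \<Rightarrow> state \<Rightarrow> bool" where
  "same_sides s s' = foldr (\<lambda>e acc. if side_at s' (fst e) = snd e then acc else False) s True"

definition exchange :: "state \<Rightarrow> nat \<Rightarrow> nat \<Rightarrow> state" where
  "exchange s p q = foldr (\<lambda>e acc. (transpose p q (fst e), snd e) # acc) s []"

definition qubits :: "state \<Rightarrow> nat list" where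
  "qubits s = foldr (\<lambda>e acc. fst e # acc) s []"

text \<open>
  The head of the accumulated list is the cheapest entry so far among \<open>x\<close> and the entries of \<open>t\<close>
  with the same occupied set as \<open>x\<close>; its tail consists of the remaining entries of \<open>t\<close>.
\<close>

definition insert_entry :: "entry \<Rightarrow> entry list \<Rightarrow> entry list" where
  "insert_entry x t = foldr (\<lambda>e acc.
     if same_sides (state e) (state (hd acc))
     then (if cost (hd acc) \<le> cost e then acc else e # tl acc)
     else hd acc # e # tl acc) t [x]"

definition separates :: "state \<Rightarrow> nat set \<Rightarrow> bool" where
  "separates s g \<longleftrightarrow> side_at s (Min g) \<noteq> side_at s (Max g)"

text \<open>
  A round has a target: a gate, or \<^const>\<open>None\<close> in the rounds before any gate is processed, in which
  exchanges are free and nothing is recorded, because the search may start from any order.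
\<close>

definition passes :: "nat set option \<Rightarrow> entry \<Rightarrow> bool" where
  "passes g x = (case g of None \<Rightarrow> True | Some h \<Rightarrow> separates (state x) h)"

definition recorded :: "nat set option \<Rightarrow> entry \<Rightarrow> entry" where
  "recorded g x =
     (case g of None \<Rightarrow> x | Some h \<Rightarrow> (cost x, state x, qubits (state x) # path x))"

definition admit :: "nat set option \<Rightarrow> entry \<Rightarrow> entry list \<Rightarrow> entry list" where
  "admit g x t = (if passes g x then insert_entry (recorded g x) t else t)"

text \<open>
  Two cells of a state stand for a proposed exchange.  Cells on the same side stand for staying put,
  so that one double loop over the cells tries both kinds of candidates.
\<close>

definition move :: "nat set option \<Rightarrow> entry \<Rightarrow> nat \<times> bool \<Rightarrow> nat \<times> bool \<Rightarrow> entry" where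
  "move g e p q =
     (if snd p = snd q then e
      else (if g = None then cost e else Suc (cost e), exchange (state e) (fst p) (fst q), path e))"

definition try_partners ::
  "nat set option \<Rightarrow> entry \<Rightarrow> nat \<times> bool \<Rightarrow> state \<Rightarrow> entry list \<Rightarrow> entry list" where
  "try_partners g e p s t = foldr (\<lambda>q. admit g (move g e p q)) s t"

definition try_moves :: "nat set option \<Rightarrow> entry \<Rightarrow> state \<Rightarrow> entry list \<Rightarrow> entry list" where
  "try_moves g e s t = foldr (\<lambda>p. try_partners g e p (state e)) s t"

definition search_round :: "nat set option \<Rightarrow> entry list \<Rightarrow> entry list" where
  "search_round g t = foldr (\<lambda>e. try_moves g e (state e)) t []"

definition free_rounds :: "nat \<Rightarrow> entry list \<Rightarrow> entry list" where
  "free_rounds k t = foldr (\<lambda>_. search_round None) [0..<k] t"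

definition gate_rounds :: "nat set list \<Rightarrow> entry list \<Rightarrow> entry list" where
  "gate_rounds C t = foldr (\<lambda>g. search_round (Some g)) C t"

definition cheapest :: "entry list \<Rightarrow> entry option" where
  "cheapest t = foldr (\<lambda>e acc. case acc of None \<Rightarrow> Some e
     | Some a \<Rightarrow> if cost a \<le> cost e then Some a else Some e) t None"

lemma same_sides_iff: "same_sides s s' \<longleftrightarrow> (\<forall>e\<in>set s. side_at s' (fst e) = snd e)"
  unfolding same_sides_def by (induction s) auto

lemma exchange_map: "exchange s p q = map (\<lambda>e. (transpose p q (fst e), snd e)) s"
  unfolding exchange_def by (induction s) auto

lemma qubits_map: "qubits s = map fst s"
  unfolding qubits_def by (induction s) auto

lemma free_rounds_0: "free_rounds 0 t = t"
  by (simp add: free_rounds_def)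

lemma foldr_const: "foldr (\<lambda>_. f) xs a = (f ^^ length xs) a"
  by (induction xs) auto

lemma free_rounds_Suc: "free_rounds (Suc k) t = search_round None (free_rounds k t)"
  by (simp add: free_rounds_def foldr_const funpow_swap1 del: upt_Suc)

lemma cheapest_minimal:
  assumes "t \<noteq> []"
  obtains e where "cheapest t = Some e" "e \<in> set t" "\<forall>e'\<in>set t. cost e \<le> cost e'"
proof -
  have "\<exists>e. cheapest t = Some e \<and> e \<in> set t \<and> (\<forall>e'\<in>set t. cost e \<le> cost e')"
    using assms
  proof (induction t)
    case (Cons x t)
    show ?case
    proof (cases "t = []")
      case True
      then show ?thesis by (simp add: cheapest_def)
    next
      case False
      with Cons.IH obtain e where "cheapest t = Some e" "e \<in> set t" "\<forall>e'\<in>set t. cost e \<le> cost e'"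
        by blast
      then show ?thesis
        by (intro exI[of _ "if cost e \<le> cost x then e else x"])
          (auto simp: cheapest_def intro: order_trans)
    qed
  qed simp
  then show ?thesis using that by blast
qed

section \<open>Correctness of the search\<close>

context bipartite
begin

definition order_state :: "(nat \<Rightarrow> nat) \<Rightarrow> state" where
  "order_state \<tau> = map (\<lambda>i. (\<tau> i, side i)) [1..<Suc n]"

definition order_list :: "(nat \<Rightarrow> nat) \<Rightarrow> nat list" where
  "order_list \<tau> = map \<tau> [1..<Suc n]"

text \<open>
  The path of an entry is a feasible sequence of orders for the gates processed so far, and it costs at
  most what the entry claims.  The bound by the number of gates limits the size of the unary cost.
\<close>

definition sound :: "nat set list \<Rightarrow> entry \<Rightarrow> bool" where
  "sound C e \<longleftrightarrow> (\<exists>\<tau> \<tau>s. \<tau> permutes {1..n} \<and> state e = order_state \<tau> \<and>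
     path e = map order_list \<tau>s \<and> nncp_feasible n E C \<tau>s \<and> nncp_cost E \<tau>s \<le> cost e \<and>
     (\<tau>s \<noteq> [] \<longrightarrow> hd \<tau>s = \<tau>) \<and> cost e \<le> length C)"

text \<open>
  The occupied set of the order of an entry, expressed by its state.  At most one entry is kept for
  each key.
\<close>

definition key :: "entry \<Rightarrow> nat set" where
  "key e = {q \<in> {1..n}. side_at (state e) q}"

definition table_ok :: "nat set list \<Rightarrow> entry list \<Rightarrow> bool" where
  "table_ok C t \<longleftrightarrow> (\<forall>e\<in>set t. sound C e) \<and> distinct (map key t)"

definition covers :: "entry list \<Rightarrow> entry \<Rightarrow> bool" where
  "covers t x \<longleftrightarrow> (\<exists>y\<in>set t. key y = key x \<and> cost y \<le> cost x)"

lemma side_at_order_state: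
  assumes "\<tau> permutes {1..n}" "q \<in> {1..n}"
  shows "side_at (order_state \<tau>) q = side (inv \<tau> q)"
proof -
  have eq: "\<tau> i = q \<longleftrightarrow> i = inv \<tau> q" for i
    using permutes_inverses[OF assms(1)] by metis
  have "side_at (map (\<lambda>i. (\<tau> i, side i)) xs) q = (inv \<tau> q \<in> set xs \<and> side (inv \<tau> q))" for xs
    unfolding side_at_def by (induction xs) (auto simp: eq)
  moreover have "inv \<tau> q \<in> set [1..<Suc n]"
    using permutes_in_image[OF permutes_inv[OF assms(1)], of q] assms(2) by auto
  ultimately show ?thesis unfolding order_state_def by blast
qed

lemma key_order_state:
  assumes "\<tau> permutes {1..n}" "state e = order_state \<tau>"
  shows "key e = occupied \<tau>"
  using assms by (auto simp: key_def occupied_def side_at_order_state)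

lemma sound_key:
  assumes "sound C e"
  shows "key e \<subseteq> {1..n}" "finite (key e)" "card (key e) = capacity"
  using assms key_order_state card_occupied finite_occupied
  by (auto simp: sound_def) (auto simp: key_def)

lemma set_order_state: "set (order_state \<tau>) = (\<lambda>i. (\<tau> i, side i)) ` {1..n}"
  unfolding order_state_def by (auto simp: image_iff)

lemma set_order_state_perm:
  assumes "\<tau> permutes {1..n}"
  shows "(q, b) \<in> set (order_state \<tau>) \<longleftrightarrow> q \<in> {1..n} \<and> b = side (inv \<tau> q)"
proof
  assume "(q, b) \<in> set (order_state \<tau>)"
  then obtain i where "i \<in> {1..n}" "q = \<tau> i" "b = side i"
    unfolding set_order_state by blast
  then show "q \<in> {1..n} \<and> b = side (inv \<tau> q)"
    using permutes_in_image[OF assms, of i] permutes_inverses(2)[OF assms] by simp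
next
  assume q: "q \<in> {1..n} \<and> b = side (inv \<tau> q)"
  then have "inv \<tau> q \<in> {1..n}"
    using permutes_in_image[OF permutes_inv[OF assms], of q] by blast
  moreover have "(q, b) = (\<tau> (inv \<tau> q), side (inv \<tau> q))"
    using q permutes_inverses(1)[OF assms] by simp
  ultimately show "(q, b) \<in> set (order_state \<tau>)"
    unfolding set_order_state by blast
qed

lemma length_order_state: "length (order_state \<tau>) = n"
  by (simp add: order_state_def)

lemma same_sides_iff_key:
  assumes "sound C e" "sound C' e'"
  shows "same_sides (state e) (state e') \<longleftrightarrow> key e = key e'"
proof -
  from assms obtain \<tau> \<tau>' where \<tau>: "\<tau> permutes {1..n}" "state e = order_state \<tau>"
    and \<tau>': "\<tau>' permutes {1..n}" "state e' = order_state \<tau>'"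
    by (auto simp: sound_def)
  have "same_sides (state e) (state e') \<longleftrightarrow>
      (\<forall>q\<in>{1..n}. side_at (state e') q = side (inv \<tau> q))"
    unfolding same_sides_iff \<tau>(2) Ball_def split_paired_All
      set_order_state_perm[OF \<tau>(1)] fst_conv snd_conv by blast
  also have "\<dots> \<longleftrightarrow> key e = key e'"
  proof -
    have iff: "(\<forall>q\<in>A. P q = Q q) \<longleftrightarrow> {q \<in> A. Q q} = {q \<in> A. P q}" for A :: "nat set" and P Q
      by auto
    show ?thesis unfolding key_order_state[OF \<tau>] unfolding occupied_def key_def by (rule iff)
  qed
  finally show ?thesis .
qed

lemma insert_entry_shape:
  assumes "\<forall>e\<in>set t. sound C e" "sound C x"
  shows "\<exists>y. insert_entry x t = y # filter (\<lambda>e. key e \<noteq> key x) t \<and> y \<in> insert x (set t) \<and>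
    key y = key x \<and> cost y \<le> cost x \<and> (\<forall>e\<in>set t. key e = key x \<longrightarrow> cost y \<le> cost e)"
  using assms(1)
proof (induction t)
  case Nil
  then show ?case by (simp add: insert_entry_def)
next
  case (Cons e t)
  then obtain y where y: "insert_entry x t = y # filter (\<lambda>e. key e \<noteq> key x) t"
    "y \<in> insert x (set t)" "key y = key x" "cost y \<le> cost x"
    "\<forall>e\<in>set t. key e = key x \<longrightarrow> cost y \<le> cost e"
    by auto
  have "insert_entry x (e # t) =
      (if same_sides (state e) (state (hd (insert_entry x t)))
       then (if cost (hd (insert_entry x t)) \<le> cost e then insert_entry x t
             else e # tl (insert_entry x t))
       else hd (insert_entry x t) # e # tl (insert_entry x t))"
    by (simp add: insert_entry_def)
  moreover have "same_sides (state e) (state y) \<longleftrightarrow> key e = key x"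
    using same_sides_iff_key[of C e C y] y Cons.prems assms(2) by auto
  ultimately have eq: "insert_entry x (e # t) =
      (if key e = key x
       then (if cost y \<le> cost e then y else e) # filter (\<lambda>e. key e \<noteq> key x) t
       else y # e # filter (\<lambda>e. key e \<noteq> key x) t)"
    using y(1) by simp
  show ?case
  proof (cases "key e = key x \<and> \<not> cost y \<le> cost e")
    case True
    then show ?thesis using eq y by (intro exI[of _ e]) (simp, meson nat_le_linear order_trans)
  next
    case False
    then show ?thesis using eq y by (intro exI[of _ y]) auto
  qed
qed

lemma table_ok_insert_entry:
  assumes "table_ok C t" "sound C x"
  shows "table_ok C (insert_entry x t)"
proof -
  obtain y where "insert_entry x t = y # filter (\<lambda>e. key e \<noteq> key x) t"
    "y \<in> insert x (set t)" "key y = key x"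
    using insert_entry_shape[of t C x] assms by (auto simp: table_ok_def)
  then show ?thesis using assms by (auto simp: table_ok_def distinct_map_filter)
qed

lemma covers_insert_entry:
  assumes "table_ok C t" "sound C x" "covers t z \<or> z = x"
  shows "covers (insert_entry x t) z"
proof -
  obtain y where y: "insert_entry x t = y # filter (\<lambda>e. key e \<noteq> key x) t"
    "y \<in> insert x (set t)" "key y = key x" "cost y \<le> cost x"
    "\<forall>e\<in>set t. key e = key x \<longrightarrow> cost y \<le> cost e"
    using insert_entry_shape[of t C x] assms by (auto simp: table_ok_def)
  show ?thesis
  proof (cases "key z = key x")
    case True
    then have "cost y \<le> cost z"
      using assms(3) y(4,5) unfolding covers_def by (metis order_trans)
    then show ?thesis using y True unfolding covers_def by (intro bexI[of _ y]) auto
  next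
    case False
    with assms(3) obtain w where "w \<in> set t" "key w = key z" "cost w \<le> cost z"
      unfolding covers_def by blast
    then show ?thesis using y(1) False unfolding covers_def by (intro bexI[of _ w]) auto
  qed
qed

text \<open>
  The reason why the running time is polynomial: the keys are distinct sets of the same size.
\<close>

lemma table_ok_length:
  assumes "table_ok C t"
  shows "length t \<le> n choose capacity"
proof -
  have "length t = card (key ` set t)"
    using assms by (metis distinct_card length_map list.set_map table_ok_def)
  also have "key ` set t \<subseteq> {S. S \<subseteq> {1..n} \<and> card S = capacity}"
    using assms sound_key unfolding table_ok_def by blast
  then have "card (key ` set t) \<le> card {S. S \<subseteq> {1..n} \<and> card S = capacity}"
    by (intro card_mono) auto
  also have "\<dots> = n choose capacity" by (simp add: n_subsets)
  finally show ?thesis .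
qed

definition after :: "nat set option \<Rightarrow> nat set list \<Rightarrow> nat set list" where
  "after g C = (case g of None \<Rightarrow> C | Some h \<Rightarrow> h # C)"

text \<open>
  Free rounds take place only before any gate has been processed: a free exchange afterwards would
  have to be paid for.
\<close>

definition admissible :: "nat set option \<Rightarrow> nat set list \<Rightarrow> bool" where
  "admissible g C = (case g of None \<Rightarrow> C = [] | Some h \<Rightarrow> h \<subseteq> {1..n} \<and> card h = 2)"

lemma passes_iff:
  assumes "h \<subseteq> {1..n}" "card h = 2"
  shows "passes (Some h) x \<longleftrightarrow> card (h \<inter> key x) = 1"
proof -
  from assms(2) obtain a b where ab: "h = {a, b}" "a \<noteq> b" by (meson card_2_iff)
  then have "passes (Some h) x \<longleftrightarrow> side_at (state x) a \<noteq> side_at (state x) b"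
    by (auto simp: passes_def separates_def min_def max_def)
  also have "\<dots> \<longleftrightarrow> (a \<in> key x) \<noteq> (b \<in> key x)"
    using ab assms(1) by (auto simp: key_def)
  also have "\<dots> \<longleftrightarrow> card (h \<inter> key x) = 1"
    using ab by (auto simp: Int_insert_left)
  finally show ?thesis .
qed

lemma move_state:
  assumes "\<tau> permutes {1..n}" "state e = order_state \<tau>" "p \<in> set (state e)" "q \<in> set (state e)"
  obtains \<tau>' where "\<tau>' permutes {1..n}" "state (move g e p q) = order_state \<tau>'"
    "J (edge_transpositions E) \<tau>' \<tau> + cost e \<le> cost (move g e p q) \<or> g = None"
proof (cases "snd p = snd q")
  case True
  then show ?thesis using that[of \<tau>] assms by (auto simp: move_def J_refl)
next
  case False
  have p: "fst p \<in> {1..n}" "snd p = side (inv \<tau> (fst p))"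
    and q: "fst q \<in> {1..n}" "snd q = side (inv \<tau> (fst q))"
    using assms set_order_state_perm[OF assms(1)] by (metis prod.collapse)+
  have "state (move g e p q) = order_state (transpose (fst p) (fst q) \<circ> \<tau>)"
    using False assms(2) by (simp add: move_def exchange_map order_state_def del: upt_Suc)
  moreover have "transpose (fst p) (fst q) \<circ> \<tau> permutes {1..n}"
    using p q assms(1) by (simp add: permutes_compose permutes_swap_id)
  moreover have "J (edge_transpositions E) (transpose (fst p) (fst q) \<circ> \<tau>) \<tau> + cost e
      \<le> cost (move g e p q) \<or> g = None"
    using J_exchange_le[OF assms(1) p(1) q(1)] p q False by (auto simp: move_def)
  ultimately show ?thesis using that by blast
qed

text \<open>
  The new order differs from the head of the path by at most one exchange, which the cost of a gate
  round pays for.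
\<close>

lemma sound_recorded_move:
  assumes "sound C e" "p \<in> set (state e)" "q \<in> set (state e)" "admissible g C"
    and "passes g (move g e p q)"
  shows "sound (after g C) (recorded g (move g e p q))"
proof -
  from assms(1) obtain \<tau> \<tau>s where \<tau>: "\<tau> permutes {1..n}" "state e = order_state \<tau>"
    and \<tau>s: "path e = map order_list \<tau>s" "nncp_feasible n E C \<tau>s" "nncp_cost E \<tau>s \<le> cost e"
      "\<tau>s \<noteq> [] \<Longrightarrow> hd \<tau>s = \<tau>" "cost e \<le> length C"
    by (auto simp: sound_def)
  from move_state[OF \<tau> assms(2,3), of g] obtain \<tau>' where \<tau>': "\<tau>' permutes {1..n}"
    "state (move g e p q) = order_state \<tau>'"
    "J (edge_transpositions E) \<tau>' \<tau> + cost e \<le> cost (move g e p q) \<or> g = None" .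
  have path: "path (move g e p q) = path e" by (simp add: move_def)
  show ?thesis
  proof (cases g)
    case None
    with assms(4) have "C = []" by (simp add: admissible_def)
    with \<tau>s None \<tau>' path show ?thesis
      by (auto simp: sound_def recorded_def after_def nncp_feasible_Nil nncp_cost_Nil move_def)
  next
    case (Some h)
    then have h: "h \<subseteq> {1..n}" "card h = 2" using assms(4) by (auto simp: admissible_def)
    have "card (h \<inter> occupied \<tau>') = 1"
      using passes_iff[OF h] assms(5) key_order_state[OF \<tau>'(1,2)] Some by metis
    then have "nncp_feasible n E (h # C) (\<tau>' # \<tau>s)"
      using \<tau>s(2) \<tau>'(1) h by (simp add: nncp_feasible_Cons complies_iff_card)
    moreover have "nncp_cost E (\<tau>' # \<tau>s) \<le> cost (move g e p q)"
    proof (cases \<tau>s)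
      case Nil
      then show ?thesis by (simp add: nncp_cost_single)
    next
      case (Cons \<tau>\<^sub>1 \<tau>s\<^sub>1)
      then show ?thesis using \<tau>s(3,4) \<tau>'(3) Some by (simp add: nncp_cost_Cons)
    qed
    moreover have "cost (move g e p q) \<le> Suc (length C)"
      using \<tau>s(5) by (simp add: move_def)
    moreover have "qubits (order_state \<tau>') = order_list \<tau>'"
      by (simp add: qubits_map order_state_def order_list_def comp_def)
    ultimately show ?thesis
      unfolding sound_def using Some \<tau>' \<tau>s(1) path
      by (intro exI[of _ \<tau>'] exI[of _ "\<tau>' # \<tau>s"]) (simp add: recorded_def after_def)
  qed
qed

lemma key_recorded: "key (recorded g x) = key x"
  by (auto simp: recorded_def key_def split: option.split)

lemma cost_recorded: "cost (recorded g x) = cost x"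
  by (auto simp: recorded_def split: option.split)

lemma table_ok_admit:
  assumes "table_ok (after g C) t" "sound C e" "p \<in> set (state e)" "q \<in> set (state e)"
    "admissible g C"
  shows "table_ok (after g C) (admit g (move g e p q) t)"
  using assms sound_recorded_move table_ok_insert_entry by (simp add: admit_def)

lemma covers_admit:
  assumes "table_ok (after g C) t" "sound C e" "p \<in> set (state e)" "q \<in> set (state e)"
    "admissible g C" "covers t z \<or> (z = move g e p q \<and> passes g z)"
  shows "covers (admit g (move g e p q) t) z"
proof (cases "passes g (move g e p q)")
  case True
  have "covers t z \<or> z = move g e p q" using assms(6) by blast
  then have "covers t z \<or> covers (insert_entry (recorded g (move g e p q)) t)
     (recorded g (move g e p q)) \<and> z = move g e p q"
    using covers_insert_entry[OF assms(1) sound_recorded_move[OF assms(2-5) True]] by blast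
  then show ?thesis
    using covers_insert_entry[OF assms(1) sound_recorded_move[OF assms(2-5) True], of z] True
    by (auto simp: admit_def covers_def key_recorded cost_recorded)
next
  case False
  then show ?thesis using assms(6) by (auto simp: admit_def)
qed

lemma table_ok_foldr:
  assumes "table_ok C t" "\<And>x t. x \<in> set xs \<Longrightarrow> table_ok C t \<Longrightarrow> table_ok C (f x t)"
  shows "table_ok C (foldr f xs t)"
  using assms by (induction xs) auto

lemma covers_foldr:
  assumes ok: "table_ok C t" "\<And>x t. x \<in> set xs \<Longrightarrow> table_ok C t \<Longrightarrow> table_ok C (f x t)"
    and keep: "\<And>x t. x \<in> set xs \<Longrightarrow> table_ok C t \<Longrightarrow> covers t z \<Longrightarrow> covers (f x t) z"
    and new: "covers t z \<or> (\<exists>x\<in>set xs. \<forall>t. table_ok C t \<longrightarrow> covers (f x t) z)"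
  shows "covers (foldr f xs t) z"
  using assms
proof (induction xs)
  case (Cons x xs)
  have okxs: "table_ok C (foldr f xs t)" using Cons.prems(1,2) by (intro table_ok_foldr) auto
  show ?case
  proof (cases "\<forall>t. table_ok C t \<longrightarrow> covers (f x t) z")
    case True
    then show ?thesis using okxs by simp
  next
    case False
    then have "covers (foldr f xs t) z" using Cons.prems by (intro Cons.IH) auto
    then show ?thesis using Cons.prems(3)[of x] okxs by simp
  qed
qed simp

lemma table_ok_try_partners:
  assumes "table_ok (after g C) t" "sound C e" "p \<in> set (state e)" "admissible g C"
    "set s \<subseteq> set (state e)"
  shows "table_ok (after g C) (try_partners g e p s t)"
  unfolding try_partners_def using assms by (intro table_ok_foldr table_ok_admit) auto

lemma table_ok_try_moves:
  assumes "table_ok (after g C) t" "sound C e" "admissible g C" "set s \<subseteq> set (state e)"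
  shows "table_ok (after g C) (try_moves g e s t)"
  unfolding try_moves_def using assms by (intro table_ok_foldr table_ok_try_partners) auto

lemma table_ok_search_round:
  assumes "\<forall>e\<in>set t. sound C e" "admissible g C"
  shows "table_ok (after g C) (search_round g t)"
  unfolding search_round_def using assms
  by (intro table_ok_foldr table_ok_try_moves) (auto simp: table_ok_def)

lemma covers_try_partners:
  assumes "table_ok (after g C) t" "sound C e" "p \<in> set (state e)" "admissible g C"
    "covers t z \<or> (\<exists>q\<in>set (state e). z = move g e p q \<and> passes g z)"
  shows "covers (try_partners g e p (state e) t) z"
  unfolding try_partners_def
  by (rule covers_foldr[OF assms(1)])
    (use assms table_ok_admit covers_admit in blast)+

lemma covers_try_moves:
  assumes "table_ok (after g C) t" "sound C e" "admissible g C"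
    "covers t z \<or> (\<exists>p\<in>set (state e). \<exists>q\<in>set (state e). z = move g e p q \<and> passes g z)"
  shows "covers (try_moves g e (state e) t) z"
  unfolding try_moves_def
  by (rule covers_foldr[OF assms(1)])
    (use assms table_ok_try_partners covers_try_partners in blast)+

lemma covers_search_round:
  assumes "\<forall>e\<in>set t. sound C e" "admissible g C" "e \<in> set t"
    "p \<in> set (state e)" "q \<in> set (state e)" "passes g (move g e p q)"
  shows "covers (search_round g t) (move g e p q)"
proof -
  have empty: "table_ok (after g C) []" by (simp add: table_ok_def)
  show ?thesis
    unfolding search_round_def
    by (rule covers_foldr[OF empty])
      (use assms table_ok_try_moves covers_try_moves in blast)+
qed

lemma table_ok_gate_rounds:
  assumes "circuit n C" "table_ok [] t"
  shows "table_ok C (gate_rounds C t)"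
  using assms(1)
proof (induction C)
  case Nil
  show ?case using assms(2) by (simp add: gate_rounds_def)
next
  case (Cons g C)
  then have "table_ok C (gate_rounds C t)" by (simp add: circuit_def)
  moreover have "admissible (Some g) C" using Cons.prems by (simp add: admissible_def circuit_def)
  ultimately have "table_ok (after (Some g) C) (search_round (Some g) (gate_rounds C t))"
    by (intro table_ok_search_round) (auto simp: table_ok_def)
  then show ?case by (simp add: after_def gate_rounds_def)
qed

lemma table_ok_free_rounds:
  assumes "table_ok [] t"
  shows "table_ok [] (free_rounds k t)"
proof (induction k)
  case 0
  show ?case using assms by (simp add: free_rounds_0)
next
  case (Suc k)
  then show ?case using table_ok_search_round[of "free_rounds k t" "[]" None]
    by (simp add: free_rounds_Suc table_ok_def after_def admissible_def)
qed

lemma move_stay: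
  assumes "sound C e"
  obtains p where "p \<in> set (state e)" "move g e p p = e"
proof -
  from inhabited[of True] have "n \<noteq> 0" by auto
  then have "state e \<noteq> []" using assms by (auto simp: sound_def order_state_def)
  then show ?thesis using that[of "hd (state e)"] by (simp add: move_def)
qed

lemma move_exchange:
  assumes "sound C e" "a \<in> key e" "b \<in> {1..n} - key e"
  obtains p q where "p \<in> set (state e)" "q \<in> set (state e)"
    "key (move g e p q) = insert b (key e - {a})"
    "cost (move g e p q) = (if g = None then cost e else Suc (cost e))"
proof -
  from assms(1) obtain \<tau> where \<tau>: "\<tau> permutes {1..n}" "state e = order_state \<tau>"
    by (auto simp: sound_def)
  note key = key_order_state[OF \<tau>]
  let ?p = "(a, True)" and ?q = "(b, False)"
  have p: "?p \<in> set (state e)" and q: "?q \<in> set (state e)"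
    using assms(2,3) unfolding \<tau>(2) set_order_state_perm[OF \<tau>(1)] key by (auto simp: occupied_def)
  have a: "a \<in> {1..n}" using assms(2) by (auto simp: key_def)
  have perm: "transpose a b \<circ> \<tau> permutes {1..n}"
    using a assms(3) \<tau>(1) by (simp add: permutes_compose permutes_swap_id)
  have "state (move g e ?p ?q) = order_state (transpose a b \<circ> \<tau>)"
    using \<tau>(2) by (simp add: move_def exchange_map order_state_def del: upt_Suc)
  from key_order_state[OF perm this]
  have "key (move g e ?p ?q) = transpose a b ` key e"
    unfolding key occupied_image[OF perm] occupied_image[OF \<tau>(1)] by (simp add: image_comp)
  also have "\<dots> = insert b (key e - {a})"
    using assms(2,3) by (auto simp: transpose_def image_iff)
  finally show ?thesis using that[OF p q] by (simp add: move_def)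
qed

lemma exists_exchange:
  assumes "finite A" "finite B" "card A = card B" "A \<noteq> B"
  obtains a b where "a \<in> A - B" "b \<in> B - A"
  using assms card_subset_eq by (metis Diff_eq_empty_iff all_not_in_conv)

lemma card_diff_exchange:
  assumes "finite A" "a \<in> A - B" "b \<in> B - A"
  shows "Suc (card (insert b (A - {a}) - B)) = card (A - B)"
proof -
  have "insert b (A - {a}) - B = (A - B) - {a}" using assms by auto
  then show ?thesis using assms card_Suc_Diff1[of "A - B" a] by simp
qed

text \<open>
  After \<open>k\<close> free rounds the table contains every set at distance at most \<open>k\<close> from the initial one: a
  set at distance \<open>k + 1\<close> is one exchange away from a set at distance \<open>k\<close>.
\<close>

lemma free_rounds_complete:
  assumes "table_ok [] [e\<^sub>0]" "S \<subseteq> {1..n}" "card S = capacity" "card (S - key e\<^sub>0) \<le> k"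
  shows "\<exists>e\<in>set (free_rounds k [e\<^sub>0]). key e = S"
  using assms(2-4)
proof (induction k arbitrary: S)
  case 0
  have fin: "finite S" using 0 finite_subset by blast
  then have "S \<subseteq> key e\<^sub>0" using 0 by simp
  then have "S = key e\<^sub>0"
    using 0 sound_key[of "[]" e\<^sub>0] assms(1) by (intro card_subset_eq) (auto simp: table_ok_def)
  then show ?case by (simp add: free_rounds_0)
next
  case (Suc k)
  have fin: "finite S" using Suc.prems finite_subset by blast
  have e\<^sub>0: "sound [] e\<^sub>0" using assms(1) by (simp add: table_ok_def)
  have sound: "\<forall>e\<in>set (free_rounds k [e\<^sub>0]). sound [] e"
    using table_ok_free_rounds[OF assms(1)] by (simp add: table_ok_def)
  have none: "admissible None []" "\<And>x. passes None x" by (auto simp: admissible_def passes_def)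
  show ?case
  proof (cases "card (S - key e\<^sub>0) \<le> k")
    case True
    with Suc obtain e where e: "e \<in> set (free_rounds k [e\<^sub>0])" "key e = S" by blast
    with sound have "sound [] e" by blast
    then obtain p where p: "p \<in> set (state e)" "move None e p p = e" by (rule move_stay)
    from covers_search_round[OF sound none(1) e(1) p(1) p(1) none(2)] p(2) e(2)
    show ?thesis by (auto simp: free_rounds_Suc covers_def)
  next
    case False
    then have "S \<noteq> key e\<^sub>0" by auto
    then obtain b a where ab: "b \<in> S - key e\<^sub>0" "a \<in> key e\<^sub>0 - S"
      using exists_exchange[of S "key e\<^sub>0"] fin sound_key[OF e\<^sub>0] Suc.prems by metis
    let ?S = "insert a (S - {b})"
    have "?S \<subseteq> {1..n}" using ab Suc.prems(1) sound_key(1)[OF e\<^sub>0] by auto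
    moreover have "card ?S = capacity"
      using ab fin Suc.prems(2) card_Suc_Diff1[OF fin, of b] by simp
    moreover have "card (?S - key e\<^sub>0) \<le> k"
      using card_diff_exchange[OF fin ab] Suc.prems(3) by simp
    ultimately obtain e where e: "e \<in> set (free_rounds k [e\<^sub>0])" "key e = ?S"
      using Suc.IH by blast
    with sound have "sound [] e" by blast
    moreover have "a \<in> key e" "b \<in> {1..n} - key e" using e(2) ab Suc.prems(1) by auto
    ultimately obtain p q where pq: "p \<in> set (state e)" "q \<in> set (state e)"
      "key (move None e p q) = insert b (key e - {a})" by (rule move_exchange)
    moreover have "insert b (key e - {a}) = S" using e(2) ab by auto
    ultimately show ?thesis
      using covers_search_round[OF sound none(1) e(1) pq(1,2) none(2)]
      by (auto simp: free_rounds_Suc covers_def)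
  qed
qed

text \<open>
  The invariant of the dynamic program.  Instead of an entry with key \<open>S\<close>, it only promises an entry
  whose remaining distance to \<open>S\<close> has not been paid for yet.  The arbitrary set \<open>S\<close> in front of a
  solution \<open>Ss\<close> of the processed gates makes the induction uniform: \<open>S\<close> can be the next set of a longer
  solution, and for the whole circuit it repeats the first set, at no charge.
\<close>

definition complete :: "nat set list \<Rightarrow> entry list \<Rightarrow> bool" where
  "complete C t \<longleftrightarrow> (\<forall>S Ss. (\<forall>S'\<in>set (S # Ss). S' \<subseteq> {1..n} \<and> card S' = capacity) \<longrightarrow>
     gates_split C Ss \<longrightarrow> (\<exists>e\<in>set t. cost e + card (key e - S) \<le> exchange_cost (S # Ss)))"

lemma completeD:
  assumes "complete C t" "gates_split C Ss"
    and "\<forall>S'\<in>set (S # Ss). S' \<subseteq> {1..n} \<and> card S' = capacity"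
  obtains e where "e \<in> set t" "cost e + card (key e - S) \<le> exchange_cost (S # Ss)"
  using assms unfolding complete_def by blast

text \<open>
  Why one exchange per gate suffices.  If the current set already complies with the gate, nothing is
  done.  Otherwise it contains both qubits of the gate or neither, whereas \<open>S\<close> contains exactly one;
  so there is an exchange that brings the set closer to \<open>S\<close> and involves exactly one qubit of the gate.
  All other exchanges towards \<open>S\<close> are postponed.
\<close>

lemma lazy_move:
  assumes "sound C e" "h \<subseteq> {1..n}" "card h = 2" "S \<subseteq> {1..n}" "card S = capacity"
    "card (h \<inter> S) = 1"
  obtains p q where "p \<in> set (state e)" "q \<in> set (state e)" "passes (Some h) (move (Some h) e p q)"
    "cost (move (Some h) e p q) + card (key (move (Some h) e p q) - S) \<le> cost e + card (key e - S)"
proof (cases "card (h \<inter> key e) = 1")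
  case True
  from assms(1) obtain p where "p \<in> set (state e)" "move (Some h) e p p = e" by (rule move_stay)
  then show ?thesis using that[of p p] True passes_iff[OF assms(2,3)] by simp
next
  case False
  note key = sound_key[OF assms(1)]
  have fin: "finite S" "finite h" using assms(2,4) finite_subset by blast+
  obtain u v where uv: "h = {u, v}" "u \<noteq> v" using assms(3) by (meson card_2_iff)
  have one: "card ({u, v} \<inter> X) = 1 \<longleftrightarrow> (u \<in> X) \<noteq> (v \<in> X)" for X
    using uv(2) by (auto simp: Int_insert_left)
  have "key e \<noteq> S" using False assms(6) by auto
  then obtain a\<^sub>0 b\<^sub>0 where ab\<^sub>0: "a\<^sub>0 \<in> key e - S" "b\<^sub>0 \<in> S - key e"
    using exists_exchange[of "key e" S] key fin assms(5) by metis
  have "\<exists>a b. a \<in> key e - S \<and> b \<in> S - key e \<and> card (h \<inter> insert b (key e - {a})) = 1"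
  proof (cases "u \<in> key e")
    case True
    then have "v \<in> key e" using False unfolding uv(1) one by blast
    have "(u \<in> S) \<noteq> (v \<in> S)" using assms(6) unfolding uv(1) one .
    then obtain a where a: "a = u \<or> a = v" "a \<notin> S" by blast
    with True \<open>v \<in> key e\<close> have "a \<in> key e - S" by blast
    moreover have "u \<noteq> b\<^sub>0" "v \<noteq> b\<^sub>0" using True \<open>v \<in> key e\<close> ab\<^sub>0(2) by auto
    then have "(u \<in> insert b\<^sub>0 (key e - {a})) \<noteq> (v \<in> insert b\<^sub>0 (key e - {a}))"
      using True \<open>v \<in> key e\<close> a(1) uv(2) by auto
    then have "card (h \<inter> insert b\<^sub>0 (key e - {a})) = 1" unfolding uv(1) one .
    ultimately show ?thesis using ab\<^sub>0(2) by blast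
  next
    case u: False
    then have "v \<notin> key e" using False unfolding uv(1) one by blast
    have "(u \<in> S) \<noteq> (v \<in> S)" using assms(6) unfolding uv(1) one .
    then obtain b where b: "b = u \<or> b = v" "b \<in> S" by blast
    with u \<open>v \<notin> key e\<close> have "b \<in> S - key e" by blast
    moreover have "(u \<in> insert b (key e - {a\<^sub>0})) \<noteq> (v \<in> insert b (key e - {a\<^sub>0}))"
      using u \<open>v \<notin> key e\<close> b(1) uv(2) by auto
    then have "card (h \<inter> insert b (key e - {a\<^sub>0})) = 1" unfolding uv(1) one .
    ultimately show ?thesis using ab\<^sub>0(1) by blast
  qed
  then obtain a b where ab: "a \<in> key e - S" "b \<in> S - key e"
    "card (h \<inter> insert b (key e - {a})) = 1" by blast
  then have "a \<in> key e" "b \<in> {1..n} - key e" using assms(4) by auto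
  from move_exchange[OF assms(1) this, of "Some h"] obtain p q
    where pq: "p \<in> set (state e)" "q \<in> set (state e)"
      "key (move (Some h) e p q) = insert b (key e - {a})"
      "cost (move (Some h) e p q) = (if Some h = None then cost e else Suc (cost e))" .
  then show ?thesis
    using that[OF pq(1,2)] card_diff_exchange[OF key(2) ab(1,2)] ab(3) passes_iff[OF assms(2,3)]
    by simp
qed

lemma complete_search_round:
  assumes "complete C t" "\<forall>e\<in>set t. sound C e" "h \<subseteq> {1..n}" "card h = 2"
  shows "complete (h # C) (search_round (Some h) t)"
  unfolding complete_def
proof (intro allI impI)
  fix S Ss assume Ss: "\<forall>S'\<in>set (S # Ss). S' \<subseteq> {1..n} \<and> card S' = capacity" "gates_split (h # C) Ss"
  then obtain S\<^sub>1 Ss\<^sub>1 where S\<^sub>1: "Ss = S\<^sub>1 # Ss\<^sub>1" by (cases Ss) auto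
  with Ss have "gates_split C Ss\<^sub>1" "\<forall>S'\<in>set (S\<^sub>1 # Ss\<^sub>1). S' \<subseteq> {1..n} \<and> card S' = capacity"
    by auto
  from completeD[OF assms(1) this] obtain e where e: "e \<in> set t"
    "cost e + card (key e - S\<^sub>1) \<le> exchange_cost (S\<^sub>1 # Ss\<^sub>1)" .
  have S\<^sub>1': "S\<^sub>1 \<subseteq> {1..n}" "card S\<^sub>1 = capacity" "card (h \<inter> S\<^sub>1) = 1" using Ss S\<^sub>1 by auto
  from e assms(2) have "sound C e" by blast
  from lazy_move[OF this assms(3,4) S\<^sub>1'] obtain p q
    where pq: "p \<in> set (state e)" "q \<in> set (state e)" "passes (Some h) (move (Some h) e p q)"
    and le: "cost (move (Some h) e p q) + card (key (move (Some h) e p q) - S\<^sub>1)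
      \<le> cost e + card (key e - S\<^sub>1)" .
  have "admissible (Some h) C" using assms by (simp add: admissible_def)
  from covers_search_round[OF assms(2) this e(1) pq] obtain y
    where y: "y \<in> set (search_round (Some h) t)" "key y = key (move (Some h) e p q)"
      "cost y \<le> cost (move (Some h) e p q)"
    unfolding covers_def by blast
  have fin: "finite (key y)" "finite S" "finite S\<^sub>1"
    using Ss S\<^sub>1' by (auto simp: key_def intro: finite_subset)
  have "card (S\<^sub>1 - S) = card (S - S\<^sub>1)"
    using Ss S\<^sub>1' fin by (intro card_diff_commute) auto
  then have "cost y + card (key y - S) \<le> exchange_cost (S # Ss)"
    using card_diff_triangle[OF fin(1,3), of S] e(2) le y(2,3) S\<^sub>1 by simp
  with y(1) show "\<exists>e\<in>set (search_round (Some h) t). cost e + card (key e - S)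
    \<le> exchange_cost (S # Ss)"
    by blast
qed

lemma complete_gate_rounds:
  assumes "circuit n C" "complete [] t" "table_ok [] t"
  shows "complete C (gate_rounds C t)"
  using assms(1)
proof (induction C)
  case Nil
  show ?case using assms(2) by (simp add: gate_rounds_def)
next
  case (Cons g C)
  then have "circuit n C" "g \<subseteq> {1..n}" "card g = 2" by (auto simp: circuit_def)
  moreover from this Cons have "complete C (gate_rounds C t)" by blast
  ultimately have "complete (g # C) (search_round (Some g) (gate_rounds C t))"
    using table_ok_gate_rounds[OF _ assms(3)] by (intro complete_search_round) (auto simp: table_ok_def)
  then show ?case by (simp add: gate_rounds_def)
qed

lemma complete_free_rounds:
  assumes "table_ok [] [e\<^sub>0]"
  shows "complete [] (free_rounds n [e\<^sub>0])"
  unfolding complete_def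
proof (intro allI impI)
  fix S Ss assume S: "\<forall>S'\<in>set (S # Ss). S' \<subseteq> {1..n} \<and> card S' = capacity" "gates_split [] Ss"
  have "card (S - key e\<^sub>0) \<le> card {1..n}" using S by (intro card_mono) auto
  then obtain e where e: "e \<in> set (free_rounds n [e\<^sub>0])" "key e = S"
    using free_rounds_complete[OF assms, of S n] S(1) by auto
  then have "cost e = 0"
    using table_ok_free_rounds[OF assms] by (auto simp: table_ok_def sound_def)
  with e show "\<exists>e\<in>set (free_rounds n [e\<^sub>0]). cost e + card (key e - S) \<le> exchange_cost (S # Ss)"
    by (intro bexI[of _ e]) auto
qed

text \<open>
  Without a feasible sequence the completeness invariant would be void and the table could be empty.
\<close>

lemma nncp_feasible_exists:
  assumes "circuit n C"
  shows "\<exists>\<tau>s. nncp_feasible n E C \<tau>s"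
  using assms
proof (induction C)
  case Nil
  show ?case by (simp add: nncp_feasible_Nil)
next
  case (Cons g C)
  then obtain \<tau>s where \<tau>s: "nncp_feasible n E C \<tau>s" by (auto simp: circuit_def)
  from Cons.prems obtain u v where g: "g = {u, v}" "u \<noteq> v" "u \<in> {1..n}" "v \<in> {1..n}"
    by (auto simp: circuit_def card_2_iff)
  obtain i j where ij: "i \<in> {1..n}" "side i" "j \<in> {1..n}" "\<not> side j"
    using inhabited[of True] inhabited[of False] by blast
  define \<tau> where "\<tau> = transpose (transpose i u j) v \<circ> transpose i u"
  have "i \<noteq> j" using ij by auto
  then have \<tau>: "\<tau> i = u" "\<tau> j = v" using g(2) by (auto simp: \<tau>_def transpose_def)
  have "transpose i u j \<in> {1..n}" using g ij by (auto simp: transpose_def)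
  then have perm: "\<tau> permutes {1..n}"
    unfolding \<tau>_def using g ij by (intro permutes_compose permutes_swap_id) auto
  have "inv \<tau> u = i" "inv \<tau> v = j" using \<tau> permutes_inverses(2)[OF perm] by auto
  then have "complies E \<tau> g" using ij g by (simp add: complies_def edge_iff)
  with perm \<tau>s show ?case using nncp_feasible_Cons by blast
qed

lemma search_correct:
  assumes "circuit n C" "\<tau>\<^sub>0 permutes {1..n}"
  defines "t \<equiv> gate_rounds C (free_rounds n [(0, order_state \<tau>\<^sub>0, [])])"
  obtains e \<tau>s where "cheapest t = Some e" "path e = map order_list \<tau>s" "nncp_solution n E C \<tau>s"
proof -
  let ?e = "(0, order_state \<tau>\<^sub>0, []) :: entry"
  have e\<^sub>0: "table_ok [] [?e]"
    using assms(2) by (auto simp: table_ok_def sound_def nncp_feasible_Nil nncp_cost_Nil)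
  note free = table_ok_free_rounds[OF e\<^sub>0, of n]
  have ok: "table_ok C t" unfolding t_def by (rule table_ok_gate_rounds[OF assms(1) free])
  have bound: "\<exists>e\<in>set t. cost e \<le> nncp_cost E \<tau>s" if "nncp_feasible n E C \<tau>s" for \<tau>s
  proof -
    let ?Ss = "map occupied \<tau>s" and ?S = "occupied (if \<tau>s = [] then \<tau>\<^sub>0 else hd \<tau>s)"
    have perms: "\<forall>\<tau>\<in>set \<tau>s. \<tau> permutes {1..n}"
      using that by (metis in_set_conv_nth nncp_feasible_def)
    have "exchange_cost (?S # ?Ss) = exchange_cost ?Ss" by (cases \<tau>s) auto
    moreover have sets: "\<forall>S'\<in>set (?S # ?Ss). S' \<subseteq> {1..n} \<and> card S' = capacity"
      using perms assms(2) occupied_subset card_occupied by auto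
    moreover note le = exchange_cost_le_nncp_cost[OF that assms(1)]
    moreover have "complete C t"
      using complete_gate_rounds[OF assms(1) complete_free_rounds[OF e\<^sub>0] free]
      unfolding t_def .
    from completeD[OF this conjunct1[OF le] sets] obtain e
      where "e \<in> set t" "cost e + card (key e - ?S) \<le> exchange_cost (?S # ?Ss)" .
    ultimately show ?thesis by (intro bexI[of _ e]) auto
  qed
  from nncp_feasible_exists[OF assms(1)] have "t \<noteq> []" using bound by fastforce
  from cheapest_minimal[OF this] obtain e
    where e: "cheapest t = Some e" "e \<in> set t" "\<forall>e'\<in>set t. cost e \<le> cost e'"
    by blast
  then obtain \<tau>s where \<tau>s: "path e = map order_list \<tau>s" "nncp_feasible n E C \<tau>s"
    "nncp_cost E \<tau>s \<le> cost e"
    using ok by (auto simp: table_ok_def sound_def)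
  have "nncp_solution n E C \<tau>s"
    unfolding nncp_solution_def using \<tau>s bound e(3) by (meson order_trans)
  with e(1) \<tau>s(1) show ?thesis by (rule that)
qed

end

section \<open>Evaluation with time bounds\<close>

text \<open>
  Upper bounds for the number of steps compose by addition, without determining which branch of a
  conditional is taken.
\<close>

definition runs :: "prog \<Rightarrow> tree list \<Rightarrow> exp \<Rightarrow> tree \<Rightarrow> nat \<Rightarrow> bool" where
  "runs P vs e v b \<longleftrightarrow> (\<exists>t\<le>b. eval P vs e v t)"

definition runs_all :: "prog \<Rightarrow> tree list \<Rightarrow> exp list \<Rightarrow> tree list \<Rightarrow> nat \<Rightarrow> bool" where
  "runs_all P vs es ws b \<longleftrightarrow> (\<exists>t\<le>b. evals P vs es ws t)"

lemma runs_mono: "runs P vs e v b \<Longrightarrow> b \<le> b' \<Longrightarrow> runs P vs e v b'"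
  unfolding runs_def using le_trans by blast

lemma runs_Var: "i < length vs \<Longrightarrow> v = vs ! i \<Longrightarrow> runs P vs (Var i) v 1"
  unfolding runs_def using eval_evals.Var by blast

lemma runs_Leaf: "v = Leaf \<Longrightarrow> runs P vs LeafE v 1"
  unfolding runs_def using eval_evals.Leaf by blast

lemma runs_Node:
  assumes "runs P vs e\<^sub>1 v\<^sub>1 b\<^sub>1" "runs P vs e\<^sub>2 v\<^sub>2 b\<^sub>2" "v = Node v\<^sub>1 v\<^sub>2"
  shows "runs P vs (NodeE e\<^sub>1 e\<^sub>2) v (1 + b\<^sub>1 + b\<^sub>2)"
proof -
  from assms obtain t\<^sub>1 t\<^sub>2 where "t\<^sub>1 \<le> b\<^sub>1" "eval P vs
    e\<^sub>1 v\<^sub>1 t\<^sub>1" "t\<^sub>2 \<le> b\<^sub>2" "eval P vs e\<^sub>2 v\<^sub>2 t\<^sub>2"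
    unfolding runs_def by blast
  then show ?thesis
    unfolding runs_def using eval_evals.Node[of P vs e\<^sub>1 v\<^sub>1 t\<^sub>1 e\<^sub>2 v\<^sub>2 t\<^sub>2] assms(3)
    by (intro exI[of _ "1 + t\<^sub>1 + t\<^sub>2"]) simp
qed

lemma runs_Left: "runs P vs e w b \<Longrightarrow> v = left w \<Longrightarrow> runs P vs (LeftE e) v (1 + b)"
  unfolding runs_def using eval_evals.Left by (metis add_le_cancel_left)

lemma runs_Right: "runs P vs e w b \<Longrightarrow> v = right w \<Longrightarrow> runs P vs (RightE e) v (1 + b)"
  unfolding runs_def using eval_evals.Right by (metis add_le_cancel_left)

lemma runs_If:
  assumes "runs P vs e w b"
    and "w \<noteq> Leaf \<Longrightarrow> runs P vs e\<^sub>1 v b\<^sub>1"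
    and "w = Leaf \<Longrightarrow> runs P vs e\<^sub>2 v b\<^sub>2"
  shows "runs P vs (IfE e e\<^sub>1 e\<^sub>2) v (1 + b + b\<^sub>1 + b\<^sub>2)"
proof -
  from assms(1) obtain t where t: "t \<le> b" "eval P vs e w t"
    unfolding runs_def by blast
  show ?thesis
  proof (cases "w = Leaf")
    case True
    with assms(3) obtain t' where "t' \<le> b\<^sub>2" "eval P vs e\<^sub>2 v t'"
      unfolding runs_def by blast
    then show ?thesis
      unfolding runs_def using t True eval_evals.IfLeaf[of P vs e t e\<^sub>2 v t' e\<^sub>1]
      by (intro exI[of _ "1 + t + t'"]) simp
  next
    case False
    with assms(2) obtain t' where "t' \<le> b\<^sub>1" "eval P vs e\<^sub>1 v t'"
      unfolding runs_def by blast
    then show ?thesis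
      unfolding runs_def using t False eval_evals.IfNode[of P vs e w t e\<^sub>1 v t' e\<^sub>2]
      by (intro exI[of _ "1 + t + t'"]) simp
  qed
qed

lemma runs_Nil: "ws = [] \<Longrightarrow> runs_all P vs [] ws 0"
  unfolding runs_all_def using eval_evals.NoArgs by blast

lemma runs_Cons:
  assumes "runs P vs e w b" "runs_all P vs es ws' b'" "ws = w # ws'"
  shows "runs_all P vs (e # es) ws (b + b')"
proof -
  from assms obtain t t' where "t \<le> b" "eval P vs e w t" "t' \<le> b'" "evals P vs es ws' t'"
    unfolding runs_def runs_all_def by blast
  then show ?thesis
    unfolding runs_all_def using eval_evals.MoreArgs[of P vs e w t es ws' t'] assms(3)
    by (intro exI[of _ "t + t'"]) simp
qed

lemma runs_Call:
  assumes "runs_all P vs es ws b" "f < length P" "runs P ws (P ! f) v b'"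
  shows "runs P vs (Call f es) v (1 + b + b')"
proof -
  from assms obtain t t' where "t \<le> b" "evals P vs es ws t" "t' \<le> b'" "eval P ws (P ! f) v t'"
    unfolding runs_def runs_all_def by blast
  then show ?thesis
    unfolding runs_def using eval_evals.Call[of P vs es ws t f v t'] assms(2)
    by (intro exI[of _ "1 + t + t'"]) simp
qed

lemma runs_env:
  "runs_all P (us @ vs) (map Var [length us..<length us + length vs]) vs (length vs)"
proof (induction vs arbitrary: us)
  case Nil
  show ?case by (simp add: runs_Nil)
next
  case (Cons v vs)
  have "runs_all P (us @ v # vs) (map Var [Suc (length us)..<Suc (length us) + length vs]) vs
      (length vs)"
    using Cons.IH[of "us @ [v]"] by simp
  from runs_Cons[OF runs_Var[of "length us" "us @ v # vs" v] this] show ?case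
    by (simp add: upt_conv_Cons del: upt_Suc)
qed

text \<open>
  The only form of recursion in the program below: a function that folds a list from the right,
  with the body of the fold in function \<open>h\<close> and \<open>m\<close> further parameters passed on unchanged.
  Function \<open>h\<close> receives the current element, the value for the rest of the list, and the parameters.
\<close>

definition fold_exp :: "nat \<Rightarrow> nat \<Rightarrow> nat \<Rightarrow> exp \<Rightarrow> exp" where
  "fold_exp k h m e =
     IfE (Var 0)
       (Call h (LeftE (Var 0) # Call k (RightE (Var 0) # map Var [1..<1 + m]) # map Var [1..<1 + m]))
       e"

lemma runs_fold:
  assumes k: "P ! k = fold_exp k h m e" "k < length P" "h < length P" and m: "m = length vs"
    and init: "runs P (Leaf # vs) e (encB a) b\<^sub>0"
    and step: "\<And>ys x zs. xs = ys @ x # zs \<Longrightarrow>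
      runs P (enc x # encB (foldr f zs a) # vs) (P ! h) (encB (f x (foldr f zs a))) b"
    and len: "length xs \<le> l"
  shows "runs P (enc_list enc xs # vs) (P ! k) (encB (foldr f xs a))
    (l * (b + 2 * length vs + 8) + b\<^sub>0 + 2)"
proof -
  have "runs P (enc_list enc xs # vs) (P ! k) (encB (foldr f xs a))
      (length xs * (b + 2 * length vs + 8) + b\<^sub>0 + 2)"
    using step
  proof (induction xs)
    case Nil
    have "runs P (Leaf # vs) (IfE (Var 0) e' e) (encB a) (1 + 1 + 0 + b\<^sub>0)" for e'
      by (rule runs_If[OF runs_Var[OF _ refl]]) (use init in auto)
    then show ?case by (simp add: k m fold_exp_def)
  next
    case (Cons x xs)
    let ?t = "length xs * (b + 2 * length vs + 8) + b\<^sub>0 + 2"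
    let ?vs = "Node (enc x) (enc_list enc xs) # vs"
    have env: "runs_all P ?vs (map Var [1..<1 + length vs]) vs (length vs)"
      using runs_env[of P "[Node (enc x) (enc_list enc xs)]" vs] by simp
    have IH: "runs P (enc_list enc xs # vs) (P ! k) (encB (foldr f xs a)) ?t"
      using Cons.prems by (intro Cons.IH) (metis append_Cons)
    have body: "runs P (enc x # encB (foldr f xs a) # vs) (P ! h) (encB (f x (foldr f xs a))) b"
      using Cons.prems[of "[]" x xs] by simp
    have rec: "runs P ?vs (Call k (RightE (Var 0) # map Var [1..<1 + length vs]))
        (encB (foldr f xs a)) (1 + ((1 + 1) + length vs) + ?t)"
      by (rule runs_Call[OF runs_Cons[OF runs_Right[OF runs_Var] env] k(2) IH]) auto
    have "runs P ?vs (P ! k) (encB (f x (foldr f xs a)))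
        (1 + 1 + (1 + ((1 + 1) + ((1 + ((1 + 1) + length vs) + ?t) + length vs)) + b) + 0)"
      unfolding k m fold_exp_def
      by (rule runs_If[OF runs_Var[OF _ refl]
            runs_Call[OF runs_Cons[OF runs_Left[OF runs_Var] runs_Cons[OF rec env]] k(3) body]]) auto
    then show ?case unfolding enc_list.simps foldr.simps comp_apply
      by (rule runs_mono) (simp add: algebra_simps)
  qed
  then show ?thesis
    by (rule runs_mono) (simp add: len)
qed

section \<open>The program\<close>

abbreviation TrueE :: exp where "TrueE \<equiv> NodeE LeafE LeafE"
abbreviation stateE :: "exp \<Rightarrow> exp" where "stateE e \<equiv> LeftE (RightE e)"
abbreviation pathE :: "exp \<Rightarrow> exp" where "pathE e \<equiv> RightE (RightE e)"

text \<open>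
  The numbers of the functions that are called by name.  A fold with number \<open>k\<close> has its step function
  at number \<open>k + 1\<close>.  Parameters come in the following order.
  \<^item> \<open>DIFF a b\<close> is \<open>b - a\<close>, so that it is nil iff \<open>b \<le> a\<close>.
  \<^item> \<open>EQ a b\<close>, \<open>SIDE_AT s x\<close>, \<open>EXCHANGE s p q\<close>, \<open>QUBITS s\<close>, \<open>SAME_SIDES s s'\<close>, \<open>SEPARATES s g\<close>
  \<^item> \<open>INSERT t x\<close>, \<open>ADMIT x t g\<close>, \<open>MOVE g e p q\<close>
  \<^item> \<open>TRY_PARTNERS s t g e p\<close>, \<open>TRY_MOVES s t g e\<close>, \<open>ROUND t g\<close>
  \<^item> \<open>FREE_ROUNDS k t\<close>, \<open>GATE_ROUNDS C t\<close>, \<open>CHEAPEST t\<close>, \<open>START row\<close>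
\<close>

abbreviation (input) DIFF :: nat where "DIFF \<equiv> 1"
abbreviation (input) EQ :: nat where "EQ \<equiv> 3"
abbreviation (input) SIDE_AT :: nat where "SIDE_AT \<equiv> 4"
abbreviation (input) EXCHANGE :: nat where "EXCHANGE \<equiv> 6"
abbreviation (input) QUBITS :: nat where "QUBITS \<equiv> 8"
abbreviation (input) SAME_SIDES :: nat where "SAME_SIDES \<equiv> 10"
abbreviation (input) INSERT :: nat where "INSERT \<equiv> 12"
abbreviation (input) SEPARATES :: nat where "SEPARATES \<equiv> 14"
abbreviation (input) ADMIT :: nat where "ADMIT \<equiv> 15"
abbreviation (input) MOVE :: nat where "MOVE \<equiv> 16"
abbreviation (input) TRY_PARTNERS :: nat where "TRY_PARTNERS \<equiv> 17"
abbreviation (input) TRY_MOVES :: nat where "TRY_MOVES \<equiv> 19"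
abbreviation (input) ROUND :: nat where "ROUND \<equiv> 21"
abbreviation (input) FREE_ROUNDS :: nat where "FREE_ROUNDS \<equiv> 23"
abbreviation (input) GATE_ROUNDS :: nat where "GATE_ROUNDS \<equiv> 25"
abbreviation (input) CHEAPEST :: nat where "CHEAPEST \<equiv> 27"
abbreviation (input) START :: nat where "START \<equiv> 29"

definition moved_exp :: exp where
  "moved_exp = NodeE (IfE (Var 0) (NodeE LeafE (LeftE (Var 1))) (LeftE (Var 1)))
     (NodeE (Call EXCHANGE [stateE (Var 1), LeftE (Var 2), LeftE (Var 3)]) (pathE (Var 1)))"

definition main_exp :: exp where
  "main_exp =
    RightE (RightE (Call CHEAPEST [Call GATE_ROUNDS [RightE (RightE (Var 0)),
      Call FREE_ROUNDS [LeftE (Var 0),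
        NodeE (NodeE LeafE (NodeE (Call START [LeftE (LeftE (RightE (Var 0)))]) LeafE)) LeafE]]]))"

definition diff_step :: exp where
  "diff_step =
    RightE (Var 1)"

definition eq_exp :: exp where
  "eq_exp =
    IfE (Call DIFF [Var 0, Var 1]) LeafE (IfE (Call DIFF [Var 1, Var 0]) LeafE TrueE)"

definition side_at_step :: exp where
  "side_at_step =
    IfE (Call EQ [LeftE (Var 0), Var 2]) (RightE (Var 0)) (Var 1)"

definition exchange_step :: exp where
  "exchange_step =
    NodeE (NodeE (IfE (Call EQ [LeftE (Var 0), Var 2]) (Var 3)
        (IfE (Call EQ [LeftE (Var 0), Var 3]) (Var 2) (LeftE (Var 0))))
      (RightE (Var 0))) (Var 1)"

definition qubits_step :: exp where
  "qubits_step =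
    NodeE (LeftE (Var 0)) (Var 1)"

definition same_sides_step :: exp where
  "same_sides_step =
    IfE (Call SIDE_AT [Var 2, LeftE (Var 0)])
      (IfE (RightE (Var 0)) (Var 1) LeafE) (IfE (RightE (Var 0)) LeafE (Var 1))"

definition insert_step :: exp where
  "insert_step =
    IfE (Call SAME_SIDES [stateE (Var 0), stateE (LeftE (Var 1))])
      (IfE (Call DIFF [LeftE (Var 0), LeftE (LeftE (Var 1))])
        (NodeE (Var 0) (RightE (Var 1))) (Var 1))
      (NodeE (LeftE (Var 1)) (NodeE (Var 0) (RightE (Var 1))))"

definition separates_exp :: exp where
  "separates_exp =
    IfE (Call SIDE_AT [Var 0, LeftE (Var 1)])
      (IfE (Call SIDE_AT [Var 0, RightE (Var 1)]) LeafE TrueE)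
      (Call SIDE_AT [Var 0, RightE (Var 1)])"

definition admit_exp :: exp where
  "admit_exp =
    IfE (Var 2)
      (IfE (Call SEPARATES [stateE (Var 0), Var 2])
        (Call INSERT [Var 1, NodeE (LeftE (Var 0))
          (NodeE (stateE (Var 0)) (NodeE (Call QUBITS [stateE (Var 0)]) (pathE (Var 0))))])
        (Var 1))
      (Call INSERT [Var 1, Var 0])"

definition move_exp :: exp where
  "move_exp =
    IfE (RightE (Var 2)) (IfE (RightE (Var 3)) (Var 1) moved_exp)
      (IfE (RightE (Var 3)) moved_exp (Var 1))"

definition try_partners_step :: exp where
  "try_partners_step =
    Call ADMIT [Call MOVE [Var 3, Var 4, Var 5, Var 0], Var 1, Var 3]"

definition try_moves_step :: exp where
  "try_moves_step =
    Call TRY_PARTNERS [stateE (Var 4), Var 1, Var 3, Var 4, Var 0]"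

definition round_step :: exp where
  "round_step =
    Call TRY_MOVES [stateE (Var 0), Var 1, Var 2, Var 0]"

definition free_rounds_step :: exp where
  "free_rounds_step =
    Call ROUND [Var 1, LeafE]"

definition gate_rounds_step :: exp where
  "gate_rounds_step =
    Call ROUND [Var 1, Var 0]"

definition cheapest_step :: exp where
  "cheapest_step =
    IfE (Var 1) (IfE (Call DIFF [LeftE (Var 0), LeftE (Var 1)]) (Var 0) (Var 1)) (Var 0)"

text \<open>
  Qubits are named by their distance from the end of the list, so that the next name is one more than
  the name at the head of the list built so far.  On the empty list, \<^const>\<open>left\<close> of nil is nil, the
  number 0.  The result is the reversal permutation, which serves as well as any other order.
\<close>

definition start_step :: exp where
  "start_step =
    NodeE (NodeE (NodeE LeafE (LeftE (LeftE (Var 1)))) (Var 0)) (Var 1)"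

definition nncp_prog :: prog where
  "nncp_prog = [
    main_exp,
    fold_exp DIFF 2 1 (Var 1),
    diff_step,
    eq_exp,
    fold_exp SIDE_AT 5 1 LeafE,
    side_at_step,
    fold_exp EXCHANGE 7 2 LeafE,
    exchange_step,
    fold_exp QUBITS 9 0 LeafE,
    qubits_step,
    fold_exp SAME_SIDES 11 1 TrueE,
    same_sides_step,
    fold_exp INSERT 13 1 (NodeE (Var 1) LeafE),
    insert_step,
    separates_exp,
    admit_exp,
    move_exp,
    fold_exp TRY_PARTNERS 18 4 (Var 1),
    try_partners_step,
    fold_exp TRY_MOVES 20 3 (Var 1),
    try_moves_step,
    fold_exp ROUND 22 1 LeafE,
    round_step,
    fold_exp FREE_ROUNDS 24 1 (Var 1),
    free_rounds_step,
    fold_exp GATE_ROUNDS 26 1 (Var 1),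
    gate_rounds_step,
    fold_exp CHEAPEST 28 0 LeafE,
    cheapest_step,
    fold_exp START 30 0 LeafE,
    start_step]"

lemma length_nncp_prog: "length nncp_prog = 31"
  by (simp add: nncp_prog_def)

lemma nncp_prog_nth:
  "nncp_prog ! 0 = main_exp"
  "nncp_prog ! 1 = fold_exp DIFF 2 1 (Var 1)"
  "nncp_prog ! 2 = diff_step"
  "nncp_prog ! 3 = eq_exp"
  "nncp_prog ! 4 = fold_exp SIDE_AT 5 1 LeafE"
  "nncp_prog ! 5 = side_at_step"
  "nncp_prog ! 6 = fold_exp EXCHANGE 7 2 LeafE"
  "nncp_prog ! 7 = exchange_step"
  "nncp_prog ! 8 = fold_exp QUBITS 9 0 LeafE"
  "nncp_prog ! 9 = qubits_step"
  "nncp_prog ! 10 = fold_exp SAME_SIDES 11 1 TrueE"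
  "nncp_prog ! 11 = same_sides_step"
  "nncp_prog ! 12 = fold_exp INSERT 13 1 (NodeE (Var 1) LeafE)"
  "nncp_prog ! 13 = insert_step"
  "nncp_prog ! 14 = separates_exp"
  "nncp_prog ! 15 = admit_exp"
  "nncp_prog ! 16 = move_exp"
  "nncp_prog ! 17 = fold_exp TRY_PARTNERS 18 4 (Var 1)"
  "nncp_prog ! 18 = try_partners_step"
  "nncp_prog ! 19 = fold_exp TRY_MOVES 20 3 (Var 1)"
  "nncp_prog ! 20 = try_moves_step"
  "nncp_prog ! 21 = fold_exp ROUND 22 1 LeafE"
  "nncp_prog ! 22 = round_step"
  "nncp_prog ! 23 = fold_exp FREE_ROUNDS 24 1 (Var 1)"
  "nncp_prog ! 24 = free_rounds_step"
  "nncp_prog ! 25 = fold_exp GATE_ROUNDS 26 1 (Var 1)"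
  "nncp_prog ! 26 = gate_rounds_step"
  "nncp_prog ! 27 = fold_exp CHEAPEST 28 0 LeafE"
  "nncp_prog ! 28 = cheapest_step"
  "nncp_prog ! 29 = fold_exp START 30 0 LeafE"
  "nncp_prog ! 30 = start_step"
  by (simp_all add: nncp_prog_def)

definition enc_cell :: "nat \<times> bool \<Rightarrow> tree" where
  "enc_cell c = Node (enc_nat (fst c)) (enc_bool (snd c))"

definition enc_entry :: "entry \<Rightarrow> tree" where
  "enc_entry e = Node (enc_nat (cost e))
     (Node (enc_list enc_cell (state e)) (enc_list (enc_list enc_nat) (path e)))"

definition enc_target :: "nat set option \<Rightarrow> tree" where
  "enc_target g = (case g of None \<Rightarrow> Leaf | Some h \<Rightarrow> enc_gate h)"

definition enc_choice :: "entry option \<Rightarrow> tree" where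
  "enc_choice x = (case x of None \<Rightarrow> Leaf | Some e \<Rightarrow> enc_entry e)"

lemma enc_list_const: "length xs = length ys \<Longrightarrow> enc_list (\<lambda>_. c) xs = enc_list (\<lambda>_. c) ys"
  by (induction xs ys rule: list_induct2) auto

lemma enc_nat_0: "enc_nat 0 = Leaf"
  by (simp add: enc_nat_def)

lemma enc_nat_Suc: "enc_nat (Suc k) = Node Leaf (enc_nat k)"
proof -
  have "enc_list (\<lambda>_. Leaf) [0..<Suc k] = enc_list (\<lambda>_. Leaf) (0 # [0..<k])"
    by (rule enc_list_const) simp
  then show ?thesis by (simp add: enc_nat_def)
qed

lemma enc_nat_eq_Leaf: "enc_nat k = Leaf \<longleftrightarrow> k = 0"
  by (cases k) (auto simp: enc_nat_0 enc_nat_Suc)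

lemma right_enc_nat: "right (enc_nat k) = enc_nat (k - 1)"
  by (cases k) (auto simp: enc_nat_0 enc_nat_Suc)

lemma enc_bool_eq_Leaf: "enc_bool b = Leaf \<longleftrightarrow> \<not> b"
  by (simp add: enc_bool_def)

text \<open>
  Rules for symbolic execution: if their premises are solved from left to right, they determine the
  value and the bound of an expression whose arguments are given explicitly.
\<close>

lemma runs_result: "runs P vs e v' b' \<Longrightarrow> v' = v \<Longrightarrow> b' \<le> b \<Longrightarrow> runs P vs e v b"
  using runs_mono by blast

lemma runs_Vars:
  "runs P (x\<^sub>0 # vs) (Var 0) x\<^sub>0 1"
  "runs P (x\<^sub>0 # x\<^sub>1 # vs) (Var 1) x\<^sub>1 1"
  "runs P (x\<^sub>0 # x\<^sub>1 # x\<^sub>2 # vs) (Var 2) x\<^sub>2 1"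
  "runs P (x\<^sub>0 # x\<^sub>1 # x\<^sub>2 # x\<^sub>3 # vs) (Var 3) x\<^sub>3 1"
  "runs P (x\<^sub>0 # x\<^sub>1 # x\<^sub>2 # x\<^sub>3 # x\<^sub>4 # vs) (Var 4) x\<^sub>4 1"
  "runs P (x\<^sub>0 # x\<^sub>1 # x\<^sub>2 # x\<^sub>3 # x\<^sub>4 # x\<^sub>5 # vs) (Var 5) x\<^sub>5 1"
  by (rule runs_Var; simp)+

lemma runs_If_value:
  assumes "runs P vs e w b" "w \<noteq> Leaf \<Longrightarrow> runs P vs e\<^sub>1 v\<^sub>1 b\<^sub>1" "w = Leaf \<Longrightarrow> runs P vs e\<^sub>2 v\<^sub>2 b\<^sub>2"
  shows "runs P vs (IfE e e\<^sub>1 e\<^sub>2) (if w = Leaf then v\<^sub>2 else v\<^sub>1) (1 + b + b\<^sub>1 + b\<^sub>2)"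
  by (rule runs_If[OF assms(1)]) (use assms in auto)

lemma runs_If_Leaf:
  assumes "runs P vs e Leaf b" "runs P vs e\<^sub>2 v\<^sub>2 b\<^sub>2"
  shows "runs P vs (IfE e e\<^sub>1 e\<^sub>2) v\<^sub>2 (1 + b + 0 + b\<^sub>2)"
  by (rule runs_If[OF assms(1)]) (use assms in auto)

lemma runs_If_Node:
  assumes "runs P vs e (Node l r) b" "runs P vs e\<^sub>1 v\<^sub>1 b\<^sub>1"
  shows "runs P vs (IfE e e\<^sub>1 e\<^sub>2) v\<^sub>1 (1 + b + b\<^sub>1 + 0)"
  by (rule runs_If[OF assms(1)]) (use assms in auto)

lemma runs_Left_Node: "runs P vs e (Node l r) b \<Longrightarrow> runs P vs (LeftE e) l (1 + b)"
  by (erule runs_Left) simp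

lemma runs_Right_Node: "runs P vs e (Node l r) b \<Longrightarrow> runs P vs (RightE e) r (1 + b)"
  by (erule runs_Right) simp

lemmas runs_basic = runs_Vars runs_Leaf[OF refl] runs_Node[OF _ _ refl] runs_Left_Node
  runs_Right_Node runs_Nil[OF refl] runs_Cons[OF _ _ refl]

lemmas runs_rules = runs_basic runs_If_value

text \<open>
  Bounds on the number of steps, for \<open>n\<close> qubits, costs up to \<open>m\<close> and tables of up to \<open>r\<close> entries.  The
  constants are generous.
\<close>

definition t_diff :: "nat \<Rightarrow> nat" where "t_diff k = 12 * k + 3"
definition t_eq :: "nat \<Rightarrow> nat" where "t_eq n = 2 * t_diff n + 30"
definition t_side_at :: "nat \<Rightarrow> nat" where "t_side_at n = n * (t_eq n + 40) + 10"
definition t_exchange :: "nat \<Rightarrow> nat" where "t_exchange n = n * (2 * t_eq n + 60) + 10"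
definition t_qubits :: "nat \<Rightarrow> nat" where "t_qubits n = n * 40 + 10"
definition t_same_sides :: "nat \<Rightarrow> nat" where "t_same_sides n = n * (t_side_at n + 60) + 10"
definition t_insert :: "nat \<Rightarrow> nat \<Rightarrow> nat \<Rightarrow> nat" where
  "t_insert n m r = r * (t_same_sides n + t_diff m + 90) + 10"
definition t_separates :: "nat \<Rightarrow> nat" where "t_separates n = 3 * t_side_at n + 60"
definition t_admit :: "nat \<Rightarrow> nat \<Rightarrow> nat \<Rightarrow> nat" where
  "t_admit n m r = t_separates n + t_qubits n + t_insert n m r + 100"
definition t_move :: "nat \<Rightarrow> nat" where "t_move n = 2 * t_exchange n + 100"
definition t_try_partners :: "nat \<Rightarrow> nat \<Rightarrow> nat \<Rightarrow> nat" where
  "t_try_partners n m r = n * (t_admit n m r + t_move n + 100) + 10"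
definition t_try_moves :: "nat \<Rightarrow> nat \<Rightarrow> nat \<Rightarrow> nat" where
  "t_try_moves n m r = n * (t_try_partners n m r + 100) + 10"
definition t_round :: "nat \<Rightarrow> nat \<Rightarrow> nat \<Rightarrow> nat" where
  "t_round n m r = r * (t_try_moves n m r + 100) + 10"
definition t_cheapest :: "nat \<Rightarrow> nat \<Rightarrow> nat" where
  "t_cheapest m r = r * (t_diff m + 100) + 10"
definition t_main :: "nat \<Rightarrow> nat \<Rightarrow> nat \<Rightarrow> nat" where
  "t_main n m r = t_cheapest m r + (m + n) * (t_round n m r + 100) + 100 * n + 200"

lemma runs_diff:
  assumes "a \<le> k"
  shows "runs nncp_prog [enc_nat a, enc_nat b] (nncp_prog ! 1) (enc_nat (b - a)) (t_diff k)"
proof -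
  have eq: "foldr (\<lambda>_ acc. acc - 1) xs b = b - length xs" for xs :: "nat list"
    by (induction xs) auto
  have "runs nncp_prog (enc_list (\<lambda>_. Leaf) [0..<a] # [enc_nat b]) (nncp_prog ! 1)
      (enc_nat (foldr (\<lambda>_ acc. acc - 1) [0..<a] b)) (k * (2 + 2 * length [enc_nat b] + 8) + 1 + 2)"
  proof (rule runs_fold[where h = 2 and m = 1 and e = "Var 1" and encB = enc_nat])
    show "runs nncp_prog [Leaf, enc_nat b] (Var 1) (enc_nat b) 1" by (rule runs_Vars)
    show "runs nncp_prog (Leaf # enc_nat (foldr (\<lambda>_ acc. acc - 1) zs b) # [enc_nat b])
        (nncp_prog ! 2) (enc_nat (foldr (\<lambda>_ acc. acc - 1) zs b - 1)) 2" for zs :: "nat list"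
      unfolding nncp_prog_nth diff_step_def
      by (rule runs_result, rule runs_Right[OF runs_Vars(2) refl]) (simp_all add: right_enc_nat)
  qed (use assms in \<open>simp_all add: nncp_prog_nth[unfolded One_nat_def] length_nncp_prog\<close>)
  then show ?thesis unfolding eq enc_nat_def[of a, symmetric]
    by (rule runs_result) (simp_all add: t_diff_def)
qed

lemma runs_Suc: "runs P vs x (enc_nat k) b \<Longrightarrow> runs P vs (NodeE LeafE x) (enc_nat (Suc k)) (2 + b)"
  by (rule runs_result, rule runs_Node[OF runs_Leaf[OF refl] _ refl]) (auto simp: enc_nat_Suc)

lemma runs_fst: "runs P vs x (enc_cell c) b \<Longrightarrow> runs P vs (LeftE x) (enc_nat (fst c)) (1 + b)"
  by (erule runs_Left) (simp add: enc_cell_def)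

lemma runs_snd: "runs P vs x (enc_cell c) b \<Longrightarrow> runs P vs (RightE x) (enc_bool (snd c)) (1 + b)"
  by (erule runs_Right) (simp add: enc_cell_def)

lemma runs_cost: "runs P vs x (enc_entry e) b \<Longrightarrow> runs P vs (LeftE x) (enc_nat (cost e)) (1 + b)"
  by (erule runs_Left) (simp add: enc_entry_def)

lemma runs_state:
  "runs P vs x (enc_entry e) b \<Longrightarrow> runs P vs (stateE x) (enc_list enc_cell (state e)) (1 + (1 + b))"
  by (rule runs_Left[OF runs_Right[OF _ refl]], assumption) (simp add: enc_entry_def)

lemma runs_path:
  "runs P vs x (enc_entry e) b \<Longrightarrow>
     runs P vs (pathE x) (enc_list (enc_list enc_nat) (path e)) (1 + (1 + b))"
  by (rule runs_Right[OF runs_Right[OF _ refl]], assumption) (simp add: enc_entry_def)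

lemma runs_entry:
  assumes "runs P vs x (enc_nat c) b\<^sub>1" "runs P vs y (enc_list enc_cell s) b\<^sub>2"
    and "runs P vs z (enc_list (enc_list enc_nat) p) b\<^sub>3"
  shows "runs P vs (NodeE x (NodeE y z)) (enc_entry (c, s, p)) (1 + b\<^sub>1 + (1 + b\<^sub>2 + b\<^sub>3))"
  by (rule runs_Node[OF assms(1) runs_Node[OF assms(2,3) refl]]) (simp add: enc_entry_def)

lemma runs_list_Cons:
  assumes "runs P vs x (enc a) b\<^sub>1" "runs P vs y (enc_list enc as) b\<^sub>2"
  shows "runs P vs (NodeE x y) (enc_list enc (a # as)) (1 + b\<^sub>1 + b\<^sub>2)"
  by (rule runs_Node[OF assms]) simp

lemma runs_list_Nil: "runs P vs LeafE (enc_list enc []) 1"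
  by (rule runs_Leaf) simp

lemmas runs_args = runs_Nil[OF refl] runs_Cons[OF _ _ refl]

lemma runs_call_diff:
  assumes "runs_all nncp_prog vs es [enc_nat a, enc_nat b] c" "a \<le> k"
  shows "runs nncp_prog vs (Call 1 es) (enc_nat (b - a)) (1 + c + t_diff k)"
  by (rule runs_Call[OF assms(1) _ runs_diff[OF assms(2)]]) (simp add: length_nncp_prog)

lemma runs_call_eq:
  assumes "runs_all nncp_prog vs es [enc_nat a, enc_nat b] c" "a \<le> n" "b \<le> n"
  shows "runs nncp_prog vs (Call 3 es) (enc_bool (a = b)) (1 + c + t_eq n)"
proof -
  have "runs nncp_prog [enc_nat a, enc_nat b] (nncp_prog ! 3) (enc_bool (a = b)) (t_eq n)"
    unfolding nncp_prog_nth eq_exp_def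
    by (rule runs_result, (rule runs_rules runs_call_diff[where k = n] assms)+)
      (auto simp: enc_nat_eq_Leaf enc_bool_def t_eq_def)
  from runs_Call[OF assms(1) _ this] show ?thesis by (simp add: length_nncp_prog)
qed

context
  fixes n m r :: nat
begin

definition small :: "state \<Rightarrow> bool" where
  "small s \<longleftrightarrow> length s \<le> n \<and> (\<forall>c\<in>set s. fst c \<le> n)"

definition fits :: "entry \<Rightarrow> bool" where
  "fits e \<longleftrightarrow> small (state e) \<and> cost e \<le> m"

lemma runs_call_side_at:
  assumes args: "runs_all nncp_prog vs es [enc_list enc_cell s, enc_nat x] c"
    and "small s" "x \<le> n"
  shows "runs nncp_prog vs (Call 4 es) (enc_bool (side_at s x)) (1 + c + t_side_at n)"
proof -
  have "runs nncp_prog (enc_list enc_cell s # [enc_nat x]) (nncp_prog ! 4) (enc_bool (side_at s x))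
      (n * (t_eq n + 20 + 2 * length [enc_nat x] + 8) + 1 + 2)"
    unfolding side_at_def
  proof (rule runs_fold[where h = 5 and m = 1 and e = LeafE and encB = enc_bool])
    fix ys zs :: state and e assume "s = ys @ e # zs"
    then have e: "fst e \<le> n" using assms by (auto simp: small_def)
    show "runs nncp_prog (enc_cell e # enc_bool acc # [enc_nat x]) (nncp_prog ! 5)
        (enc_bool (if fst e = x then snd e else acc)) (t_eq n + 20)" for acc
      unfolding nncp_prog_nth side_at_step_def enc_cell_def
      by (rule runs_result, (rule runs_rules runs_call_eq[where n = n] e assms(3))+)
        (auto simp: enc_bool_def)
  next
    show "runs nncp_prog (Leaf # [enc_nat x]) LeafE (enc_bool False) 1"
      by (rule runs_Leaf) (simp add: enc_bool_def)
  qed (use assms in \<open>auto simp: nncp_prog_nth[unfolded One_nat_def] length_nncp_prog small_def\<close>)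
  then have "runs nncp_prog [enc_list enc_cell s, enc_nat x] (nncp_prog ! 4)
      (enc_bool (side_at s x)) (t_side_at n)"
    by (rule runs_mono) (simp add: t_side_at_def algebra_simps)
  from runs_Call[OF args _ this] show ?thesis by (simp add: length_nncp_prog)
qed

lemma runs_call_exchange:
  assumes args: "runs_all nncp_prog vs es [enc_list enc_cell s, enc_nat p, enc_nat q] c"
    and "small s" "p \<le> n" "q \<le> n"
  shows "runs nncp_prog vs (Call 6 es) (enc_list enc_cell (exchange s p q)) (1 + c + t_exchange n)"
proof -
  have "runs nncp_prog (enc_list enc_cell s # [enc_nat p, enc_nat q]) (nncp_prog ! 6)
      (enc_list enc_cell (exchange s p q))
      (n * (2 * t_eq n + 40 + 2 * length [enc_nat p, enc_nat q] + 8) + 1 + 2)"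
    unfolding exchange_def
  proof (rule runs_fold[where h = 7 and m = 2 and e = LeafE and encB = "enc_list enc_cell"])
    fix ys zs :: state and e assume "s = ys @ e # zs"
    then have e: "fst e \<le> n" using assms by (auto simp: small_def)
    show "runs nncp_prog (enc_cell e # enc_list enc_cell acc # [enc_nat p, enc_nat q])
        (nncp_prog ! 7) (enc_list enc_cell ((transpose p q (fst e), snd e) # acc))
        (2 * t_eq n + 40)" for acc
      unfolding nncp_prog_nth exchange_step_def enc_cell_def
      by (rule runs_result, (rule runs_rules runs_call_eq[where n = n] e assms(3,4))+)
        (auto simp: enc_bool_def enc_cell_def transpose_def)
  next
    show "runs nncp_prog (Leaf # [enc_nat p, enc_nat q]) LeafE (enc_list enc_cell []) 1"
      by (rule runs_list_Nil)
  qed (use assms in \<open>auto simp: nncp_prog_nth[unfolded One_nat_def] length_nncp_prog small_def\<close>)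
  then have "runs nncp_prog [enc_list enc_cell s, enc_nat p, enc_nat q] (nncp_prog ! 6)
      (enc_list enc_cell (exchange s p q)) (t_exchange n)"
    by (rule runs_mono) (simp add: t_exchange_def algebra_simps)
  from runs_Call[OF args _ this] show ?thesis by (simp add: length_nncp_prog)
qed

lemma runs_call_qubits:
  assumes args: "runs_all nncp_prog vs es [enc_list enc_cell s] c" and "small s"
  shows "runs nncp_prog vs (Call 8 es) (enc_list enc_nat (qubits s)) (1 + c + t_qubits n)"
proof -
  have "runs nncp_prog (enc_list enc_cell s # []) (nncp_prog ! 8) (enc_list enc_nat (qubits s))
      (n * (10 + 2 * length ([] :: tree list) + 8) + 1 + 2)"
    unfolding qubits_def
  proof (rule runs_fold[where h = 9 and m = 0 and e = LeafE and encB = "enc_list enc_nat"])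
    show "runs nncp_prog (enc_cell e # enc_list enc_nat acc # [])
        (nncp_prog ! 9) (enc_list enc_nat (fst e # acc)) 10" for acc and e :: "nat \<times> bool"
      unfolding nncp_prog_nth qubits_step_def enc_cell_def
      by (rule runs_result, (rule runs_rules)+) auto
    show "runs nncp_prog (Leaf # []) LeafE (enc_list enc_nat []) 1"
      by (rule runs_list_Nil)
  qed (use assms in \<open>auto simp: nncp_prog_nth[unfolded One_nat_def] length_nncp_prog small_def\<close>)
  then have "runs nncp_prog [enc_list enc_cell s] (nncp_prog ! 8)
      (enc_list enc_nat (qubits s)) (t_qubits n)"
    by (rule runs_mono) (simp add: t_qubits_def)
  from runs_Call[OF args _ this] show ?thesis by (simp add: length_nncp_prog)
qed

lemma runs_call_same_sides:
  assumes args: "runs_all nncp_prog vs es [enc_list enc_cell s, enc_list enc_cell s'] c"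
    and "small s" "small s'"
  shows "runs nncp_prog vs (Call 10 es) (enc_bool (same_sides s s')) (1 + c + t_same_sides n)"
proof -
  have "runs nncp_prog (enc_list enc_cell s # [enc_list enc_cell s']) (nncp_prog ! 10)
      (enc_bool (same_sides s s'))
      (n * (t_side_at n + 40 + 2 * length [enc_list enc_cell s'] + 8) + 3 + 2)"
    unfolding same_sides_def
  proof (rule runs_fold[where h = 11 and m = 1 and e = TrueE and encB = enc_bool])
    fix ys zs :: state and e assume "s = ys @ e # zs"
    then have e: "fst e \<le> n" using assms by (auto simp: small_def)
    show "runs nncp_prog (enc_cell e # enc_bool acc # [enc_list enc_cell s'])
        (nncp_prog ! 11) (enc_bool (if side_at s' (fst e) = snd e then acc else False))
        (t_side_at n + 40)" for acc
      unfolding nncp_prog_nth same_sides_step_def enc_cell_def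
      by (rule runs_result,
          (rule runs_rules runs_call_side_at[unfolded enc_cell_def] e assms(3))+)
        (auto simp: enc_bool_def)
  next
    show "runs nncp_prog (Leaf # [enc_list enc_cell s']) TrueE (enc_bool True) 3"
      by (rule runs_result, (rule runs_rules)+) (auto simp: enc_bool_def)
  qed (use assms in \<open>auto simp: nncp_prog_nth[unfolded One_nat_def] length_nncp_prog small_def\<close>)
  then have "runs nncp_prog [enc_list enc_cell s, enc_list enc_cell s'] (nncp_prog ! 10)
      (enc_bool (same_sides s s')) (t_same_sides n)"
    by (rule runs_mono) (simp add: t_same_sides_def algebra_simps)
  from runs_Call[OF args _ this] show ?thesis by (simp add: length_nncp_prog)
qed

lemma runs_call_insert:
  assumes args: "runs_all nncp_prog vs es [enc_list enc_entry t, enc_entry x] c"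
    and t: "length t \<le> r" "\<forall>e\<in>set t. fits e" and x: "fits x"
  shows "runs nncp_prog vs (Call 12 es) (enc_list enc_entry (insert_entry x t))
    (1 + c + t_insert n m r)"
proof -
  have hd: "\<exists>y ys. insert_entry x zs = y # ys \<and> y \<in> insert x (set zs)" for zs
    unfolding insert_entry_def by (induction zs) auto
  have "runs nncp_prog (enc_list enc_entry t # [enc_entry x]) (nncp_prog ! 12)
      (enc_list enc_entry (insert_entry x t))
      (r * (t_same_sides n + t_diff m + 60 + 2 * length [enc_entry x] + 8) + 3 + 2)"
    unfolding insert_entry_def
  proof (rule runs_fold[where h = 13 and m = 1 and e = "NodeE (Var 1) LeafE" and encB =
    "enc_list enc_entry"], goal_cases)
    \<comment> \<open>cases 5 and 6 are the premises \<open>init\<close> and \<open>step\<close> of \<open>runs_fold\<close>\<close>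
    case (6 ys e zs)
    obtain y ys' where y: "insert_entry x zs = y # ys'" "y \<in> insert x (set zs)" using hd by blast
    with 6 t x have fits: "fits y" "fits e" by auto
    then have bounds: "small (state y)" "small (state e)" "cost e \<le> m" by (auto simp: fits_def)
    show ?case
      unfolding nncp_prog_nth insert_step_def insert_entry_def[symmetric] y(1) enc_list.simps
        list.sel enc_entry_def
      by (rule runs_result,
          (rule runs_rules runs_call_same_sides runs_call_diff[where k = m] bounds)+)
        (auto simp: enc_bool_eq_Leaf enc_nat_eq_Leaf enc_entry_def)
  next
    case 5
    show ?case by (rule runs_result, (rule runs_rules)+) auto
  qed (use t in \<open>auto simp: nncp_prog_nth[unfolded One_nat_def] length_nncp_prog\<close>)
  then have "runs nncp_prog [enc_list enc_entry t, enc_entry x] (nncp_prog ! 12)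
      (enc_list enc_entry (insert_entry x t)) (t_insert n m r)"
    by (rule runs_mono) (simp add: t_insert_def algebra_simps)
  from runs_Call[OF args _ this] show ?thesis by (simp add: length_nncp_prog)
qed

lemma runs_call_separates:
  assumes args: "runs_all nncp_prog vs es [enc_list enc_cell s, enc_gate g] c"
    and "small s" "Min g \<le> n" "Max g \<le> n"
  shows "runs nncp_prog vs (Call 14 es) (enc_bool (separates s g)) (1 + c + t_separates n)"
proof -
  have "runs nncp_prog [enc_list enc_cell s, enc_gate g] (nncp_prog ! 14)
      (enc_bool (separates s g)) (t_separates n)"
    unfolding nncp_prog_nth separates_exp_def enc_gate_def
    by (rule runs_result, (rule runs_rules runs_call_side_at assms(2-))+)
      (auto simp: enc_bool_def t_separates_def separates_def)
  from runs_Call[OF args _ this] show ?thesis by (simp add: length_nncp_prog)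
qed

lemma runs_call_admit:
  assumes args: "runs_all nncp_prog vs es [enc_entry x, enc_list enc_entry t, enc_target g] c"
    and t: "length t \<le> r" "\<forall>e\<in>set t. fits e" and x: "fits x"
    and g: "\<And>h. g = Some h \<Longrightarrow> Min h \<le> n \<and> Max h \<le> n"
  shows "runs nncp_prog vs (Call 15 es) (enc_list enc_entry (admit g x t)) (1 + c + t_admit n m r)"
proof -
  have s: "small (state x)" using x by (simp add: fits_def)
  note entry = runs_cost[OF runs_Vars(1)] runs_state[OF runs_Vars(1)] runs_path[OF runs_Vars(1)]
    runs_entry runs_list_Cons[where enc = "enc_list enc_nat"]
  have "runs nncp_prog [enc_entry x, enc_list enc_entry t, enc_target g] (nncp_prog ! 15)
      (enc_list enc_entry (admit g x t)) (t_admit n m r)"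
  proof (cases g)
    case None
    show ?thesis
      unfolding nncp_prog_nth admit_exp_def None enc_target_def option.case
      by (rule runs_result, (rule runs_If_Leaf runs_Vars runs_args runs_call_insert t x)+)
        (auto simp: admit_def passes_def recorded_def t_admit_def)
  next
    case (Some h)
    have h: "Min h \<le> n" "Max h \<le> n" using g[OF Some] by auto
    have x': "fits (cost x, state x, qubits (state x) # path x)" using x by (simp add: fits_def)
    have node: "runs P (a # b # enc_gate h # us) (Var 2)
        (Node (enc_nat (Min h)) (enc_nat (Max h))) 1" for P a b us
      by (rule runs_Var) (auto simp: enc_gate_def)
    show ?thesis
      unfolding nncp_prog_nth admit_exp_def Some enc_target_def option.case
      by (rule runs_result, rule runs_If_Node[OF node],
          (rule runs_If_value entry runs_Vars runs_args runs_call_separates runs_call_qubits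
            runs_call_insert t x' h s)+)
        (auto simp: enc_bool_eq_Leaf admit_def passes_def recorded_def t_admit_def)
  qed
  from runs_Call[OF args _ this] show ?thesis by (simp add: length_nncp_prog)
qed

lemma runs_call_move:
  assumes args: "runs_all nncp_prog vs es [enc_target g, enc_entry e, enc_cell p, enc_cell q] c"
    and e: "small (state e)" and p: "fst p \<le> n" and q: "fst q \<le> n"
  shows "runs nncp_prog vs (Call 16 es) (enc_entry (move g e p q)) (1 + c + t_move n)"
proof -
  let ?env = "[enc_target g, enc_entry e, enc_cell p, enc_cell q]"
  note parts = runs_cost[OF runs_Vars(2)] runs_state[OF runs_Vars(2)] runs_path[OF runs_Vars(2)]
    runs_fst[OF runs_Vars(3)] runs_fst[OF runs_Vars(4)]
    runs_snd[OF runs_Vars(3)] runs_snd[OF runs_Vars(4)]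
  have moved: "runs nncp_prog ?env moved_exp (enc_entry (if g = None then cost e else Suc (cost e),
      exchange (state e) (fst p) (fst q), path e)) (t_exchange n + 30)"
  proof (cases g)
    case None
    show ?thesis
      unfolding moved_exp_def None enc_target_def option.case
      by (rule runs_result, (rule runs_If_Leaf runs_Vars runs_args parts runs_entry
            runs_call_exchange e p q)+) auto
  next
    case (Some h)
    have node: "runs P (enc_gate h # us) (Var 0)
        (Node (enc_nat (Min h)) (enc_nat (Max h))) 1" for P us
      by (rule runs_Var) (auto simp: enc_gate_def)
    show ?thesis
      unfolding moved_exp_def Some enc_target_def option.case
      by (rule runs_result, (rule runs_If_Node[OF node] runs_Suc runs_Vars runs_args
        parts runs_entry
            runs_call_exchange e p q)+) auto
  qed
  have "runs nncp_prog ?env (nncp_prog ! 16) (enc_entry (move g e p q)) (t_move n)"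
    unfolding nncp_prog_nth move_exp_def
    by (rule runs_result, (rule moved runs_If_value runs_Vars parts)+)
      (auto simp: enc_bool_eq_Leaf move_def t_move_def)
  from runs_Call[OF args _ this] show ?thesis by (simp add: length_nncp_prog)
qed

end

section \<open>Running time of the search\<close>

context bipartite
begin

lemma small_order_state:
  assumes "\<tau> permutes {1..n}"
  shows "small n (order_state \<tau>)"
  using set_order_state_perm[OF assms] unfolding small_def by (auto simp: length_order_state)

lemma fits_sound: "sound C e \<Longrightarrow> length C \<le> m \<Longrightarrow> fits n m e"
  unfolding sound_def fits_def using small_order_state by auto

lemma fits_move:
  assumes "sound C e" "p \<in> set (state e)" "q \<in> set (state e)" "length (after g C) \<le> m"
  shows "fits n m (move g e p q)"
proof -
  from assms(1) obtain \<tau> where \<tau>: "\<tau> permutes {1..n}" "state e = order_state \<tau>"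
    by (auto simp: sound_def)
  from move_state[OF \<tau> assms(2,3)] small_order_state have "small n (state (move g e p q))" by metis
  moreover have "cost (move g e p q) \<le> length (after g C)"
    using assms(1) by (cases g) (auto simp: move_def sound_def after_def)
  ultimately show ?thesis using assms(4) by (simp add: fits_def)
qed

lemma small_sound: "sound C e \<Longrightarrow> small n (state e)"
  unfolding sound_def using small_order_state by auto

lemma table_fits:
  assumes "table_ok C t" "length C \<le> m" "n choose capacity \<le> r"
  shows "length t \<le> r" "\<forall>e\<in>set t. fits n m e"
  using table_ok_length[OF assms(1)] assms fits_sound by (auto simp: table_ok_def)

lemma admissible_bounds:
  assumes "admissible g C" "g = Some h"
  shows "Min h \<le> n \<and> Max h \<le> n"
proof -
  from assms have h: "h \<subseteq> {1..n}" "card h = 2" by (auto simp: admissible_def)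
  then have "finite h" "h \<noteq> {}" by (auto intro: finite_subset)
  then show ?thesis using h(1) Min_in[of h] Max_in[of h] by (meson atLeastAtMost_iff subsetD)
qed

context
  fixes m r :: nat
  assumes r: "n choose capacity \<le> r"
begin

lemma runs_call_try_partners:
  assumes args: "runs_all nncp_prog vs es
      [enc_list enc_cell s, enc_list enc_entry t, enc_target g, enc_entry e, enc_cell p] c"
    and ok: "table_ok (after g C) t" "sound C e" "p \<in> set (state e)" "admissible g C"
      "set s \<subseteq> set (state e)"
    and len: "length s \<le> n" "length (after g C) \<le> m"
  shows "runs nncp_prog vs (Call 17 es) (enc_list enc_entry (try_partners g e p s t))
    (1 + c + t_try_partners n m r)"
proof -
  have small: "small n (state e)" using ok(2) by (rule small_sound)
  have "runs nncp_prog (enc_list enc_cell s # [enc_list enc_entry t,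
    enc_target g, enc_entry e, enc_cell p])
      (nncp_prog ! 17) (enc_list enc_entry (foldr (\<lambda>q. admit g (move g e p q)) s t))
      (n * (t_admit n m r + t_move n + 30 + 2 *
        length [enc_list enc_entry t, enc_target g, enc_entry e, enc_cell p] + 8) + 1 + 2)"
  proof (rule runs_fold[where h = 18 and m = 4 and e = "Var 1" and encB = "enc_list enc_entry"],
      goal_cases)
    case (6 ys q zs)
    let ?acc = "foldr (\<lambda>q. admit g (move g e p q)) zs t"
    have q: "q \<in> set (state e)" using 6 ok(5) by auto
    have "set zs \<subseteq> set (state e)" using 6 ok(5) by auto
    then have "table_ok (after g C) ?acc"
      using table_ok_try_partners[OF ok(1-4)] by (simp add: try_partners_def)
    note acc = table_fits[OF this len(2) r]
    note move = fits_move[OF ok(2,3) q len(2)]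
    have pq: "fst p \<le> n" "fst q \<le> n" using small ok(3) q by (auto simp: small_def)
    show ?case
      unfolding nncp_prog_nth try_partners_step_def
      by (rule runs_result, (rule runs_Vars runs_args runs_call_move[where n = n]
            runs_call_admit[where n = n and m = m and r = r] acc move
            admissible_bounds[OF ok(4)] small pq | assumption)+) auto
  next
    case 5
    show ?case by (rule runs_Vars)
  qed (use len in \<open>simp_all add: nncp_prog_nth[unfolded One_nat_def] length_nncp_prog\<close>)
  then have "runs nncp_prog [enc_list enc_cell s, enc_list enc_entry t,
    enc_target g, enc_entry e, enc_cell p]
      (nncp_prog ! 17) (enc_list enc_entry (try_partners g e p s t)) (t_try_partners n m r)"
    unfolding try_partners_def by (rule runs_mono) (simp add: t_try_partners_def algebra_simps)
  from runs_Call[OF args _ this] show ?thesis by (simp add: length_nncp_prog)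
qed

lemma runs_call_try_moves:
  assumes args: "runs_all nncp_prog vs es
      [enc_list enc_cell s, enc_list enc_entry t, enc_target g, enc_entry e] c"
    and ok: "table_ok (after g C) t" "sound C e" "admissible g C" "set s \<subseteq> set (state e)"
    and len: "length s \<le> n" "length (after g C) \<le> m"
  shows "runs nncp_prog vs (Call 19 es) (enc_list enc_entry (try_moves g e s t))
    (1 + c + t_try_moves n m r)"
proof -
  have small: "length (state e) \<le> n" using small_sound[OF ok(2)] by (simp add: small_def)
  have "runs nncp_prog (enc_list enc_cell s # [enc_list enc_entry t, enc_target g, enc_entry e])
      (nncp_prog ! 19) (enc_list enc_entry (foldr (\<lambda>p. try_partners g e p (state e)) s t))
      (n * (t_try_partners n m r + 30 + 2 *
        length [enc_list enc_entry t, enc_target g, enc_entry e] + 8) + 1 + 2)"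
  proof (rule runs_fold[where h = 20 and m = 3 and e = "Var 1" and encB = "enc_list enc_entry"],
      goal_cases)
    case (6 ys p zs)
    let ?acc = "foldr (\<lambda>p. try_partners g e p (state e)) zs t"
    have p: "p \<in> set (state e)" using 6 ok(4) by auto
    have "set zs \<subseteq> set (state e)" using 6 ok(4) by auto
    then have acc: "table_ok (after g C) ?acc"
      using table_ok_try_moves[OF ok(1-3)] by (simp add: try_moves_def)
    show ?case
      unfolding nncp_prog_nth try_moves_step_def
      by (rule runs_result, (rule runs_Vars runs_state[OF runs_Vars(5)] runs_args
            runs_call_try_partners[where C = C] acc ok(2,3) p small len(2) subset_refl)+) auto
  next
    case 5
    show ?case by (rule runs_Vars)
  qed (use len in \<open>simp_all add: nncp_prog_nth[unfolded One_nat_def] length_nncp_prog\<close>)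
  then have "runs nncp_prog [enc_list enc_cell s, enc_list enc_entry t, enc_target g, enc_entry e]
      (nncp_prog ! 19) (enc_list enc_entry (try_moves g e s t)) (t_try_moves n m r)"
    unfolding try_moves_def by (rule runs_mono) (simp add: t_try_moves_def algebra_simps)
  from runs_Call[OF args _ this] show ?thesis by (simp add: length_nncp_prog)
qed

lemma runs_call_round:
  assumes args: "runs_all nncp_prog vs es [enc_list enc_entry t, enc_target g] c"
    and ok: "table_ok C t" "admissible g C" and len: "length (after g C) \<le> m"
  shows "runs nncp_prog vs (Call 21 es) (enc_list enc_entry (search_round g t))
    (1 + c + t_round n m r)"
proof -
  have length: "length t \<le> r" using table_ok_length[OF ok(1)] r by simp
  have empty: "table_ok (after g C) []" by (simp add: table_ok_def)
  have "runs nncp_prog (enc_list enc_entry t # [enc_target g])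
      (nncp_prog ! 21) (enc_list enc_entry (foldr (\<lambda>e. try_moves g e (state e)) t []))
      (r * (t_try_moves n m r + 30 + 2 * length [enc_target g] + 8) + 1 + 2)"
  proof (rule runs_fold[where h = 22 and m = 1 and e = LeafE and encB = "enc_list enc_entry"],
      goal_cases)
    case (6 ys e zs)
    let ?acc = "foldr (\<lambda>e. try_moves g e (state e)) zs []"
    have e: "sound C e" using 6 ok(1) by (auto simp: table_ok_def)
    have "\<forall>e\<in>set zs. sound C e" using 6 ok(1) by (auto simp: table_ok_def)
    from table_ok_search_round[OF this ok(2)] have acc: "table_ok (after g C) ?acc"
      by (simp add: search_round_def)
    have small: "length (state e) \<le> n" using small_sound[OF e] by (simp add: small_def)
    show ?case
      unfolding nncp_prog_nth round_step_def
      by (rule runs_result, (rule runs_Vars runs_state[OF runs_Vars(1)] runs_args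
            runs_call_try_moves[where C = C] acc e ok(2) small len subset_refl)+) auto
  next
    case 5
    show ?case by (rule runs_list_Nil)
  qed (use length in \<open>simp_all add: nncp_prog_nth[unfolded One_nat_def] length_nncp_prog\<close>)
  then have "runs nncp_prog [enc_list enc_entry t, enc_target g]
      (nncp_prog ! 21) (enc_list enc_entry (search_round g t)) (t_round n m r)"
    unfolding search_round_def by (rule runs_mono) (simp add: t_round_def algebra_simps)
  from runs_Call[OF args _ this] show ?thesis by (simp add: length_nncp_prog)
qed

lemma runs_call_free_rounds:
  assumes args: "runs_all nncp_prog vs es [enc_nat k, enc_list enc_entry t] c"
    and ok: "table_ok [] t"
  shows "runs nncp_prog vs (Call 23 es) (enc_list enc_entry (free_rounds k t))
    (1 + c + (k * (t_round n m r + 40) + 10))"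
proof -
  have target: "enc_target None = Leaf" by (simp add: enc_target_def)
  have "runs nncp_prog (enc_list (\<lambda>_. Leaf) [0..<k] # [enc_list enc_entry t])
      (nncp_prog ! 23) (enc_list enc_entry (foldr (\<lambda>_. search_round None) [0..<k] t))
      (k * (t_round n m r + 20 + 2 * length [enc_list enc_entry t] + 8) + 1 + 2)"
  proof (rule runs_fold[where h = 24 and m = 1 and e = "Var 1" and encB = "enc_list enc_entry"],
      goal_cases)
    case (6 ys e zs)
    have "foldr (\<lambda>_. search_round None) zs t = free_rounds (length zs) t"
      by (simp add: free_rounds_def foldr_const)
    then have acc: "table_ok [] (foldr (\<lambda>_. search_round None) zs t)"
      using table_ok_free_rounds[OF ok] by simp
    have none: "admissible None []" "length (after None []) \<le> m"
      by (auto simp: admissible_def after_def)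
    show ?case
      unfolding nncp_prog_nth free_rounds_step_def
      by (rule runs_result, (rule runs_Vars runs_Leaf[OF target] runs_args
            runs_call_round[where C = "[]"] acc none)+) auto
  next
    case 5
    show ?case by (rule runs_Vars)
  qed (simp_all add: nncp_prog_nth[unfolded One_nat_def] length_nncp_prog)
  then have "runs nncp_prog [enc_nat k, enc_list enc_entry t]
      (nncp_prog ! 23) (enc_list enc_entry (free_rounds k t)) (k * (t_round n m r + 40) + 10)"
    unfolding free_rounds_def enc_nat_def by (rule runs_mono) (simp add: algebra_simps)
  from runs_Call[OF args _ this] show ?thesis by (simp add: length_nncp_prog)
qed

lemma runs_call_gate_rounds:
  assumes args: "runs_all nncp_prog vs es [enc_list enc_gate C, enc_list enc_entry t] c"
    and ok: "table_ok [] t" and C: "circuit n C" "length C \<le> m"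
  shows "runs nncp_prog vs (Call 25 es) (enc_list enc_entry (gate_rounds C t))
    (1 + c + (m * (t_round n m r + 40) + 10))"
proof -
  have "runs nncp_prog (enc_list enc_gate C # [enc_list enc_entry t])
      (nncp_prog ! 25) (enc_list enc_entry (foldr (\<lambda>g. search_round (Some g)) C t))
      (m * (t_round n m r + 20 + 2 * length [enc_list enc_entry t] + 8) + 1 + 2)"
  proof (rule runs_fold[where h = 26 and m = 1 and e = "Var 1" and encB = "enc_list enc_entry"],
      goal_cases)
    case (6 ys g zs)
    then have "circuit n zs" and g: "g \<subseteq> {1..n}" "card g = 2" using C by (auto simp: circuit_def)
    from table_ok_gate_rounds[OF this(1) ok]
    have acc: "table_ok zs (foldr (\<lambda>g. search_round (Some g)) zs t)"
      by (simp add: gate_rounds_def)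
    have some: "admissible (Some g) zs" "length (after (Some g) zs) \<le> m"
      using g 6 C(2) by (auto simp: admissible_def after_def)
    have target: "enc_target (Some g) = enc_gate g" by (simp add: enc_target_def)
    show ?case
      unfolding nncp_prog_nth gate_rounds_step_def
      by (rule runs_result, (rule runs_Vars runs_args
            runs_call_round[where C = zs and g = "Some g", unfolded target] acc some)+) auto
  next
    case 5
    show ?case by (rule runs_Vars)
  qed (use C in \<open>simp_all add: nncp_prog_nth[unfolded One_nat_def] length_nncp_prog\<close>)
  then have "runs nncp_prog [enc_list enc_gate C, enc_list enc_entry t]
      (nncp_prog ! 25) (enc_list enc_entry (gate_rounds C t)) (m * (t_round n m r + 40) + 10)"
    unfolding gate_rounds_def by (rule runs_mono) (simp add: algebra_simps)
  from runs_Call[OF args _ this] show ?thesis by (simp add: length_nncp_prog)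
qed

end

end

lemma runs_call_cheapest:
  assumes args: "runs_all nncp_prog vs es [enc_list enc_entry t] c"
    and t: "length t \<le> r" "\<forall>e\<in>set t. cost e \<le> m"
  shows "runs nncp_prog vs (Call 27 es) (enc_choice (cheapest t)) (1 + c + t_cheapest m r)"
proof -
  have "runs nncp_prog (enc_list enc_entry t # []) (nncp_prog ! 27) (enc_choice (cheapest t))
      (r * (t_diff m + 30 + 2 * length ([] :: tree list) + 8) + 1 + 2)"
    unfolding cheapest_def
  proof (rule runs_fold[where h = 28 and m = 0 and e = LeafE and encB = enc_choice], goal_cases)
    case (6 ys e zs)
    have e: "cost e \<le> m" using 6 t(2) by auto
    note parts = runs_cost[OF runs_Vars(1)] runs_cost[OF runs_Vars(2)]
    show ?case
    proof (cases "cheapest zs")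
      case None
      show ?thesis
        unfolding nncp_prog_nth cheapest_step_def None[unfolded cheapest_def] option.case
          enc_choice_def
        by (rule runs_result, (rule runs_If_Leaf runs_Vars)+) auto
    next
      case (Some a)
      have node: "runs P (x # enc_entry a # us) (Var 1) (Node (enc_nat (cost a))
          (Node (enc_list enc_cell (state a)) (enc_list (enc_list enc_nat) (path a)))) 1" for P x us
        by (rule runs_Var) (auto simp: enc_entry_def)
      have choice: "enc_choice (if b then Some a else Some e) = (if b then enc_entry a
        else enc_entry e)"
        for b by (simp add: enc_choice_def)
      have some: "enc_choice (Some a) = enc_entry a" by (simp add: enc_choice_def)
      show ?thesis
        unfolding nncp_prog_nth cheapest_step_def Some[unfolded cheapest_def] option.case choice some
        by (rule runs_result, rule runs_If_Node[OF node], (rule runs_If_value runs_Vars runs_args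
              runs_call_diff[where k = m] parts e)+) (auto simp: enc_nat_eq_Leaf)
    qed
  next
    case 5
    show ?case by (rule runs_Leaf) (simp add: enc_choice_def)
  qed (use t in \<open>simp_all add: nncp_prog_nth[unfolded One_nat_def] length_nncp_prog\<close>)
  then have "runs nncp_prog [enc_list enc_entry t] (nncp_prog ! 27) (enc_choice (cheapest t))
      (t_cheapest m r)"
    by (rule runs_mono) (simp add: t_cheapest_def algebra_simps)
  from runs_Call[OF args _ this] show ?thesis by (simp add: length_nncp_prog)
qed

definition start_state :: "bool list \<Rightarrow> state" where
  "start_state bs = foldr (\<lambda>b acc. (Suc (length acc), b) # acc) bs []"

lemma runs_call_start:
  assumes args: "runs_all nncp_prog vs es [enc_list enc_bool bs] c" and len: "length bs \<le> n"
  shows "runs nncp_prog vs (Call 29 es) (enc_list enc_cell (start_state bs)) (1 + c + (n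
    * 40 + 10))"
proof -
  have hd: "left (left (enc_list enc_cell (start_state zs))) = enc_nat (length
    (start_state zs))" for zs
    by (cases zs) (auto simp: start_state_def enc_cell_def enc_nat_0)
  have "runs nncp_prog (enc_list enc_bool bs # []) (nncp_prog ! 29)
      (enc_list enc_cell (start_state bs)) (n * (20 + 2 * length ([] :: tree list) + 8) + 1 + 2)"
    unfolding start_state_def
  proof (rule runs_fold[where h = 30 and m = 0 and e = LeafE and encB = "enc_list enc_cell"],
      goal_cases)
    case (6 ys b zs)
    note name = runs_Left[OF runs_Left[OF runs_Vars(2) refl] hd[symmetric]]
    show ?case
      unfolding nncp_prog_nth start_step_def start_state_def[symmetric]
      by (rule runs_result, (rule name runs_Vars runs_Suc runs_Node[OF _ _ refl])+)
        (auto simp: enc_cell_def)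
  next
    case 5
    show ?case by (rule runs_list_Nil)
  qed (use len in \<open>simp_all add: nncp_prog_nth[unfolded One_nat_def] length_nncp_prog\<close>)
  then have "runs nncp_prog [enc_list enc_bool bs] (nncp_prog ! 29)
      (enc_list enc_cell (start_state bs)) (n * 40 + 10)"
    by (rule runs_mono) (simp add: algebra_simps)
  from runs_Call[OF args _ this] show ?thesis by (simp add: length_nncp_prog)
qed

section \<open>Input and output of the program\<close>

lemma enc_list_map: "enc_list f (map g xs) = enc_list (\<lambda>x. f (g x)) xs"
  by (induction xs) auto

lemma length_start_state: "length (start_state bs) = length bs"
  unfolding start_state_def by (induction bs) auto

lemma nth_start_state: "i < length bs \<Longrightarrow> start_state bs ! i = (length bs - i, bs ! i)"
proof (induction bs arbitrary: i)
  case (Cons b bs)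
  have "start_state (b # bs) = (Suc (length bs), b) # start_state bs"
    using length_start_state[of bs] by (simp add: start_state_def)
  then show ?case using Cons by (cases i) auto
qed simp

lemma enc_orders_map:
  "enc_orders n \<tau>s = enc_list (enc_list enc_nat) (map (\<lambda>\<tau>. map \<tau> [1..<Suc n]) \<tau>s)"
  unfolding enc_orders_def enc_list_map ..

context bipartite
begin

lemma start_state_order:
  obtains \<tau> where "\<tau> permutes {1..n}" "start_state (map side [1..<Suc n]) = order_state \<tau>"
proof -
  define \<tau> where "\<tau> i = (if i \<in> {1..n} then Suc n - i else i)" for i
  have "bij_betw \<tau> {1..n} {1..n}"
    by (rule bij_betw_byWitness[where f' = \<tau>]) (auto simp: \<tau>_def)
  then have "\<tau> permutes {1..n}" by (rule bij_imp_permutes) (auto simp: \<tau>_def)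
  moreover have "start_state (map side [1..<Suc n]) = order_state \<tau>"
    by (rule nth_equalityI)
      (auto simp: length_start_state nth_start_state order_state_def \<tau>_def simp del: upt_Suc)
  ultimately show ?thesis by (rule that)
qed

text \<open>
  One program serves all graphs; only the bound \<open>r\<close> on the size of the table depends on the sizes of
  the two sides.
\<close>

lemma nncp_prog_correct:
  assumes side: "\<And>i. side i \<longleftrightarrow> {1, i} \<in> E" and C: "circuit n C" and r: "n choose capacity \<le> r"
  obtains \<tau>s where "nncp_solution n E C \<tau>s"
    "runs nncp_prog [enc_instance n E C] (nncp_prog ! 0) (enc_orders n \<tau>s) (t_main n (length C) r)"
proof -
  let ?row = "map side [1..<Suc n]"
  obtain \<tau>\<^sub>0 where \<tau>\<^sub>0: "\<tau>\<^sub>0 permutes {1..n}" "start_state ?row = order_state \<tau>\<^sub>0"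
    by (rule start_state_order)
  let ?t\<^sub>0 = "[(0, start_state ?row, [])] :: entry list"
  have "table_ok [] ?t\<^sub>0"
    using \<tau>\<^sub>0 by (auto simp: table_ok_def sound_def nncp_feasible_Nil nncp_cost_Nil)
  note ok\<^sub>0 = this table_ok_free_rounds[OF this, of n]
  let ?t = "gate_rounds C (free_rounds n ?t\<^sub>0)"
  have ok: "table_ok C ?t" by (rule table_ok_gate_rounds[OF C ok\<^sub>0(2)])
  note t = table_fits[OF ok order.refl r]
  have costs: "\<forall>e\<in>set ?t. cost e \<le> length C" using t(2) by (auto simp: fits_def)
  from search_correct[OF C \<tau>\<^sub>0(1)] obtain e \<tau>s
    where e: "cheapest ?t = Some e" "path e = map order_list \<tau>s" and sol: "nncp_solution n E C \<tau>s"
    unfolding \<tau>\<^sub>0(2) by blast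
  from inhabited[of True] have "1 \<le> n" by auto
  then have graph: "enc_graph n E = Node (enc_list enc_bool ?row)
      (enc_list (\<lambda>i. enc_list (\<lambda>j. enc_bool ({i, j} \<in> E)) [1..<Suc n]) [2..<Suc n])"
    unfolding enc_graph_def enc_list_map side
    by (simp add: upt_conv_Cons numeral_2_eq_2 del: upt_Suc)
  have start: "runs P vs LeafE (enc_list (enc_list enc_nat) []) 1" "runs P vs LeafE (enc_nat 0) 1"
    "runs P vs LeafE (enc_list enc_entry []) 1" for P vs
    by (rule runs_Leaf; simp add: enc_nat_0)+
  have row: "length ?row \<le> n" by simp
  have entry: "runs nncp_prog [enc_instance n E C] (NodeE (NodeE LeafE
        (NodeE (Call START [LeftE (LeftE (RightE (Var 0)))]) LeafE)) LeafE)
      (enc_list enc_entry ?t\<^sub>0) (50 * n + 60)"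
    unfolding enc_instance_def graph
    by (rule runs_result, (rule start runs_entry runs_list_Cons[where enc = enc_entry]
          runs_call_start[where n = n] row
          runs_args runs_Vars runs_Left_Node runs_Right_Node)+) auto
  have choice: "enc_choice (Some e) = enc_entry e" by (simp add: enc_choice_def)
  have inputs: "runs nncp_prog [enc_instance n E C] (LeftE (Var 0)) (enc_nat n) 2"
    "runs nncp_prog [enc_instance n E C] (RightE (RightE (Var 0))) (enc_list enc_gate C) 3"
    unfolding enc_instance_def
    by (rule runs_result, (rule runs_Vars runs_Left_Node runs_Right_Node)+; simp)+
  have "runs nncp_prog [enc_instance n E C] (nncp_prog ! 0)
      (enc_list (enc_list enc_nat) (path e)) (t_main n (length C) r)"
    unfolding nncp_prog_nth main_exp_def
    by (rule runs_result, (rule runs_path[OF runs_call_cheapest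
      [where t = ?t and m = "length C" and r = r, unfolded e(1) choice]]
          runs_args runs_call_gate_rounds[OF r _ ok\<^sub>0(2) C order.refl]
          runs_call_free_rounds[where m = "length C", OF r _ ok\<^sub>0(1)] inputs entry t(1) costs)+)
      (auto simp: t_main_def algebra_simps)
  moreover have "enc_orders n \<tau>s = enc_list (enc_list enc_nat) (path e)"
    unfolding enc_orders_map e(2) order_list_def ..
  ultimately show ?thesis using that[OF sol] by simp
qed

end

section \<open>Polynomial bounds\<close>

text \<open>
  The base \<^term>\<open>Suc (n + m)\<close> is positive, so that powers of it are monotone in the exponent and the
  bounds are closed under sums and products.
\<close>

definition poly_bounded :: "(nat \<Rightarrow> nat \<Rightarrow> nat) \<Rightarrow> bool" where
  "poly_bounded f \<longleftrightarrow> (\<exists>c d. \<forall>n m. f n m \<le> c * Suc (n + m) ^ d)"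

lemma poly_bounded_const: "poly_bounded (\<lambda>n m. k)"
  unfolding poly_bounded_def by (intro exI[of _ k] exI[of _ 0]) simp

lemma poly_bounded_fst: "poly_bounded (\<lambda>n m. n)"
  unfolding poly_bounded_def by (intro exI[of _ 1] exI[of _ 1]) simp

lemma poly_bounded_snd: "poly_bounded (\<lambda>n m. m)"
  unfolding poly_bounded_def by (intro exI[of _ 1] exI[of _ 1]) simp

lemma poly_bounded_add:
  assumes "poly_bounded f" "poly_bounded g"
  shows "poly_bounded (\<lambda>n m. f n m + g n m)"
proof -
  from assms obtain c d c' d' where f: "\<And>n m. f n m \<le> c * Suc (n + m) ^ d"
    and g: "\<And>n m. g n m \<le> c' * Suc (n + m) ^ d'"
    unfolding poly_bounded_def by blast
  have "f n m + g n m \<le> (c + c') * Suc (n + m) ^ (d + d')" for n m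
  proof -
    have "c * Suc (n + m) ^ d \<le> c * Suc (n + m) ^ (d + d')"
      "c' * Suc (n + m) ^ d' \<le> c' * Suc (n + m) ^ (d + d')"
      by (intro mult_left_mono power_increasing; simp)+
    from order_trans[OF f this(1)] order_trans[OF g this(2)]
    show ?thesis unfolding add_mult_distrib by (rule add_mono)
  qed
  then show ?thesis unfolding poly_bounded_def by blast
qed

lemma poly_bounded_mult:
  assumes "poly_bounded f" "poly_bounded g"
  shows "poly_bounded (\<lambda>n m. f n m * g n m)"
proof -
  from assms obtain c d c' d' where f: "\<And>n m. f n m \<le> c * Suc (n + m) ^ d"
    and g: "\<And>n m. g n m \<le> c' * Suc (n + m) ^ d'"
    unfolding poly_bounded_def by blast
  have "f n m * g n m \<le> (c * c') * Suc (n + m) ^ (d + d')" for n m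
    using mult_le_mono[OF f g, of n m n m] by (simp add: power_add mult_ac)
  then show ?thesis unfolding poly_bounded_def by blast
qed

lemma poly_bounded_power: "poly_bounded f \<Longrightarrow> poly_bounded (\<lambda>n m. f n m ^ k)"
  by (induction k) (simp_all add: poly_bounded_const poly_bounded_mult)

lemma poly_bounded_sum_form:
  assumes "poly_bounded f"
  obtains c d where "\<And>n m. f n m \<le> c * (n + m) ^ d + c"
proof -
  from assms obtain c d where f: "\<And>n m. f n m \<le> c * Suc (n + m) ^ d"
    unfolding poly_bounded_def by blast
  have "Suc x ^ d \<le> 2 ^ d * x ^ d + 2 ^ d" for x :: nat
  proof (cases x)
    case (Suc y)
    have "Suc x ^ d \<le> (2 * x) ^ d" using Suc by (intro power_mono) auto
    then show ?thesis by (simp add: power_mult_distrib)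
  qed (use one_le_power[of "2 :: nat" d] in \<open>simp add: trans_le_add2\<close>)
  then have "c * Suc (n + m) ^ d \<le> c * (2 ^ d * (n + m) ^ d + 2 ^ d)" for n m
    by (intro mult_left_mono) auto
  then have "f n m \<le> (c * 2 ^ d) * (n + m) ^ d + c * 2 ^ d" for n m
    using f[of n m] order_trans by (fastforce simp: algebra_simps)
  then show ?thesis by (rule that)
qed

lemma poly_bounded_t_main: "poly_bounded (\<lambda>n m. t_main n m (n ^ M))"
  unfolding t_main_def t_round_def t_cheapest_def t_try_moves_def t_try_partners_def t_move_def
    t_admit_def t_separates_def t_insert_def t_same_sides_def t_qubits_def t_exchange_def
    t_side_at_def t_eq_def t_diff_def
  by (intro poly_bounded_add poly_bounded_mult poly_bounded_power poly_bounded_const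
      poly_bounded_fst poly_bounded_snd)

section \<open>Complete bipartite coupling graphs\<close>

text \<open>
  The first row of the adjacency matrix marks the side that does not contain location 1.  It is not
  known which of the two sides this is, and it does not matter: there are as many sets of size \<open>N\<close> as
  of size \<open>M\<close> among \<open>M + N\<close> qubits, namely at most \<open>n ^ M\<close>.
\<close>

lemma complete_bipartite_sides:
  assumes "(n, E) \<in> complete_bipartite M N" "1 \<le> M" "1 \<le> N"
  shows "bipartite n E (\<lambda>i. {1, i} \<in> E)"
    and "n choose bipartite.capacity n (\<lambda>i. {1, i} \<in> E) \<le> n ^ M"
proof -
  from assms(1) obtain A B where E: "E = {{a, b} | a b. a \<in> A \<and> b \<in> B}" and n: "n = M + N"
    and AB: "A \<union> B = {1..n}" "A \<inter> B = {}" "card A = M" "card B = N"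
    by (auto simp: complete_bipartite_def)
  have edge: "{i, j} \<in> E \<longleftrightarrow> i \<in> A \<and> j \<in> B \<or> i \<in> B \<and> j \<in> A" for i j
    unfolding E by (auto simp: doubleton_eq_iff)
  have "1 \<in> A \<union> B" using AB(1) n assms(2) by auto
  then consider "1 \<in> A" "\<And>i. {1, i} \<in> E \<longleftrightarrow> i \<in> B" | "1 \<in> B" "\<And>i. {1, i} \<in> E \<longleftrightarrow> i \<in> A"
    using AB(2) edge by blast
  then have side: "(\<forall>i. {1, i} \<in> E \<longleftrightarrow> i \<in> B) \<or> (\<forall>i. {1, i} \<in> E \<longleftrightarrow> i \<in> A)"
    by metis
  have "A \<noteq> {}" "B \<noteq> {}" using AB(3,4) assms(2,3) by auto
  then have nonempty: "\<exists>i. i \<in> A" "\<exists>i. i \<in> B" by auto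
  show sides: "bipartite n E (\<lambda>i. {1, i} \<in> E)"
  proof
    show "{i, j} \<in> E \<longleftrightarrow> i \<in> {1..n} \<and> j \<in> {1..n} \<and> ({1, i} \<in> E) \<noteq> ({1, j} \<in> E)" for i j
      using side edge[of i j] AB(1,2) by blast
    show "\<exists>i\<in>{1..n}. ({1, i} \<in> E) = b" for b
      using side nonempty AB(1,2) by (cases b) blast+
  qed
  have "{i \<in> {1..n}. {1, i} \<in> E} = A \<or> {i \<in> {1..n}. {1, i} \<in> E} = B"
    using side AB(1) by blast
  then have "bipartite.capacity n (\<lambda>i. {1, i} \<in> E) \<in> {M, N}"
    using AB(3,4) unfolding bipartite.capacity_def[OF sides] by auto
  then have "n choose bipartite.capacity n (\<lambda>i. {1, i} \<in> E) = n choose M"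
    using binomial_symmetric[of M n] n by auto
  also have "\<dots> \<le> n ^ M" using n by (intro binomial_le_pow) simp
  finally show "n choose bipartite.capacity n (\<lambda>i. {1, i} \<in> E) \<le> n ^ M" .
qed

lemma nncp_polynomial_time_complete_bipartite:
  assumes "1 \<le> M"
  shows "nncp_polynomial_time_on (\<Union>N\<in>{1..}. complete_bipartite M N)"
proof -
  obtain c d where bound: "\<And>n m. t_main n m (n ^ M) \<le> c * (n + m) ^ d + c"
    using poly_bounded_sum_form[OF poly_bounded_t_main] by blast
  have "\<exists>\<tau>s t. computes nncp_prog (enc_instance n E C) (enc_orders n \<tau>s) t \<and>
      nncp_solution n E C \<tau>s \<and> t \<le> c * (n + length C) ^ d + c"
    if graph: "(n, E) \<in> (\<Union>N\<in>{1..}. complete_bipartite M N)" and C: "circuit n C" for n E C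
  proof -
    from graph obtain N where "(n, E) \<in> complete_bipartite M N" "1 \<le> N" by auto
    note sides = complete_bipartite_sides[OF this(1) assms this(2)]
    from bipartite.nncp_prog_correct[OF sides(1) refl C sides(2)] obtain \<tau>s
      where \<tau>s: "nncp_solution n E C \<tau>s" "runs nncp_prog [enc_instance n E C] (nncp_prog ! 0)
        (enc_orders n \<tau>s) (t_main n (length C) (n ^ M))" .
    from \<tau>s(2) obtain t where "t \<le> t_main n (length C) (n ^ M)"
      "eval nncp_prog [enc_instance n E C] (nncp_prog ! 0) (enc_orders n \<tau>s) t"
      unfolding runs_def by blast
    moreover have "nncp_prog \<noteq> []" using length_nncp_prog by auto
    ultimately show ?thesis
      using \<tau>s(1) bound[of n "length C"] unfolding computes_def by (meson order_trans)
  qed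
  then show ?thesis unfolding nncp_polynomial_time_on_def by blast
qed

theorem corollary4p3:
  "(\<forall>M\<ge>1. nncp_polynomial_time_on (\<Union>N\<in>{1..}. complete_bipartite M N)) \<and>
   nncp_polynomial_time_on (\<Union>N\<in>{1..}. complete_bipartite 1 N)"
  using nncp_polynomial_time_complete_bipartite by simp

end
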